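(* Let $F$ be a field, $C$ a linear operad over $F$, and $G$ a finite group. Any (finite dimensional) simple $G$-equivariant $C$-algebra $A$ is of the form $A=\mathrm{Fun}_H(G,B)$, where $H$ is a subgroup of $G$, $B$ is a (finite dimensional) simple $C$-algebra, and $\mathrm{Fun}_H(G,B)$ is formed using a group homomorphism $\phi:H\to\mathrm{Aut}(B)$. Moreover, the subgroup $H$ is defined by $A$ uniquely up to conjugation in $G$, and $\phi$ is defined uniquely up to conjugation in $\mathrm{Aut}(B)$.
   Context: A linear operad $C$ over a field $F$ is an operad in $F$-vector spaces, with spaces of operations $C(n)$. A $C$-algebra is an $F$-vector space $A$ with a collection of linear maps $\alpha_n: C(n)\to \mathrm{Hom}_F(A^{\otimes n},A)$ compatible with the operadic structure. $\mathrm{Aut}(B)$ denotes the group of $C$-algebra automorphisms of a $C$-algebra $B$. For a $C$-algebra $A$, $E_A\subset \mathrm{End}_F(A)$ is the $F$-span of all operators $x\mapsto \alpha_n(c)(a_1,\dots,a_{j-1},x,a_j,\dots,a_{n-1})$ with $n\ge 2$, $c\in C(n)$, $1\le j\le n$, $a_1,\dots,a_{n-1}\in A$. An ideal in $A$ is a subspace $I\subset A$ such that for any $n\ge 1$, $c\in C(n)$, $j\in\{1,\dots,n\}$ and $T\in A^{\otimes (j-1)}\otimes I\otimes A^{\otimes (n-j)}$ one has $\alpha_n(c)T\in I$. A finite dimensional $C$-algebra $B$ is simple if every ideal in $B$ is either $0$ or $B$, and $E_B\neq 0$. A simple $G$-equivariant $C$-algebra is a finite dimensional $C$-algebra $A$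 with an action of $G$ (by $C$-algebra automorphisms) such that the only $G$-invariant ideals in $A$ are $0$ and $A$, and $E_A\neq 0$. For a subgroup $H\subset G$, a simple $C$-algebra $B$ and a homomorphism $\phi:H\to\mathrm{Aut}(B)$, $\mathrm{Fun}_H(G,B)$ is the space of $H$-invariant functions on $G$ with values in $B$, i.e. functions $f:G\to B$ with $f(hx)=\phi(h)f(x)$ for all $h\in H$, $x\in G$, with pointwise $C$-algebra operations and with $G$ acting by $(gf)(x)=f(xg)$. It has a natural structure of a simple $G$-equivariant $C$-algebra. The equality $A=\mathrm{Fun}_H(G,B)$ means isomorphism of $G$-equivariant $C$-algebras. *)

theory Defs
  imports
    "HOL-Algebra.Bij"
    "HOL-Combinatorics.Permutations"
    "Jordan_Normal_Form.Missing_VectorSpace"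
begin

section \<open>Permutations of blocks\<close>

text \<open>Permutations of \<open>{..<n}\<close> are functions that are the identity outside \<open>{..<n}\<close>.
  The following reads a list \<open>L\<close> as the one-line notation of such a permutation.\<close>

definition one_line :: "nat list \<Rightarrow> nat \<Rightarrow> nat" where
  "one_line L i = (if i < length L then L ! i else i)"

primrec blocks_from :: "nat \<Rightarrow> nat list \<Rightarrow> nat list list" where
  "blocks_from s [] = []"
| "blocks_from s (n # ns) = [s..<s + n] # blocks_from (s + n) ns"

abbreviation blocks :: "nat list \<Rightarrow> nat list list" where
  "blocks \<equiv> blocks_from 0"

text \<open>For \<open>ns = [n\<^sub>1,\<dots>,n\<^sub>k]\<close>, \<open>block_perm \<sigma> ns\<close> permutes \<open>k\<close> consecutive blocks of lengths
  \<open>n\<^sub>1,\<dots>,n\<^sub>k\<close> as \<open>\<sigma>\<close> permutes \<open>k\<close> letters, and \<open>sum_perm [\<tau>\<^sub>1,\<dots>,\<tau>\<^sub>k] ns\<close> is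
  \<open>\<tau>\<^sub>1 \<oplus> \<dots> \<oplus> \<tau>\<^sub>k\<close>, permuting inside each block; see the two lemmas on \<^const>\<open>permute_list\<close> below.\<close>

definition block_perm :: "(nat \<Rightarrow> nat) \<Rightarrow> nat list \<Rightarrow> nat \<Rightarrow> nat" where
  "block_perm \<sigma> ns = one_line (concat (permute_list \<sigma> (blocks ns)))"

definition sum_perm :: "(nat \<Rightarrow> nat) list \<Rightarrow> nat list \<Rightarrow> nat \<Rightarrow> nat" where
  "sum_perm \<tau>s ns = one_line (concat (map2 permute_list \<tau>s (blocks ns)))"

lemma concat_blocks_from: "concat (blocks_from s ns) = [s..<s + sum_list ns]"
proof (induction ns arbitrary: s)
  case (Cons n ns)
  then show ?case
    using upt_add_eq_append[of s "s + n" "sum_list ns"] by (simp add: add.assoc)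
qed simp

lemma length_blocks_from [simp]: "length (blocks_from s ns) = length ns"
  by (induction ns arbitrary: s) simp_all

lemma map_nth_blocks_from:
  "map (map ((!) (ys @ concat xss))) (blocks_from (length ys) (map length xss)) = xss"
proof (induction xss arbitrary: ys)
  case (Cons xs xss)
  have "map ((!) (ys @ xs @ concat xss)) [length ys..<length ys + length xs] = xs"
    by (rule nth_equalityI) (simp_all add: nth_append)
  then show ?case
    using Cons[of "ys @ xs"] by simp
qed simp

lemma map_nth_blocks: "map (map ((!) (concat xss))) (blocks (map length xss)) = xss"
  using map_nth_blocks_from[of "[]" xss] by simp

lemma one_line_permutes:
  assumes "mset L = mset [0..<n]"
  shows "one_line L permutes {..<n}"
proof -
  have len: "length L = n"
    using mset_eq_length[OF assms] by simp
  have set: "set L = {..<n}"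
    using mset_eq_setD[OF assms] by (simp only: set_upt atLeast0LessThan)
  have dist: "distinct L"
    using mset_eq_imp_distinct_iff[OF assms] by (simp only: distinct_upt)
  have "bij_betw (one_line L) {..<n} {..<n}"
    using bij_betw_nth[OF dist refl refl] unfolding len set
    by (rule bij_betw_cong[THEN iffD1, rotated]) (simp add: one_line_def len)
  then show ?thesis
    by (rule bij_imp_permutes) (simp add: one_line_def len)
qed

lemma permute_list_one_line:
  assumes "length L = length xs"
  shows "permute_list (one_line L) xs = map ((!) xs) L"
  using assms by (intro nth_equalityI) (simp_all add: permute_list_def one_line_def)

lemma mset_concat_cong:
  fixes xss yss :: "'a list list"
  shows "mset xss = mset yss \<Longrightarrow> mset (concat xss) = mset (concat yss)"
proof -
  have "mset (concat zss) = \<Sum>\<^sub># (image_mset mset (mset zss))" for zss :: "'a list list"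
    by (induction zss) simp_all
  then show "mset xss = mset yss \<Longrightarrow> mset (concat xss) = mset (concat yss)"
    by (simp only:)
qed

lemma block_perm_mset:
  assumes "\<sigma> permutes {..<length ns}"
  shows "mset (concat (permute_list \<sigma> (blocks ns))) = mset [0..<sum_list ns]"
proof -
  have "mset (concat (permute_list \<sigma> (blocks ns))) = mset (concat (blocks ns))"
    using assms by (intro mset_concat_cong) simp
  then show ?thesis
    by (simp only: concat_blocks_from add_0_left)
qed

lemma sum_perm_mset_from:
  assumes "list_all2 (\<lambda>\<tau> n. \<tau> permutes {..<n}) \<tau>s ns"
  shows "mset (concat (map2 permute_list \<tau>s (blocks_from s ns))) = mset [s..<s + sum_list ns]"
  using assms
proof (induction arbitrary: s rule: list_all2_induct)
  case Nil
  show ?case by simp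
next
  case (Cons \<tau> \<tau>s n ns)
  have "mset (concat (map2 permute_list (\<tau> # \<tau>s) (blocks_from s (n # ns)))) =
      mset (permute_list \<tau> [s..<s + n]) + mset (concat (map2 permute_list \<tau>s (blocks_from (s + n) ns)))"
    by simp
  also have "\<dots> = mset [s..<s + n] + mset [s + n..<s + n + sum_list ns]"
    using Cons.hyps(1) by (subst mset_permute_list) (simp_all only: Cons.IH length_upt add_diff_cancel_left')
  also have "\<dots> = mset ([s..<s + n] @ [s + n..<s + n + sum_list ns])"
    by (rule mset_append[symmetric])
  also have "[s..<s + n] @ [s + n..<s + n + sum_list ns] = [s..<s + sum_list (n # ns)]"
    by (metis add.assoc le_add1 sum_list.Cons upt_add_eq_append)
  finally show ?case .
qed

lemma block_perm_permutes:
  "\<sigma> permutes {..<length ns} \<Longrightarrow> block_perm \<sigma> ns permutes {..<sum_list ns}"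
  unfolding block_perm_def by (rule one_line_permutes[OF block_perm_mset])

lemma sum_perm_permutes:
  "list_all2 (\<lambda>\<tau> n. \<tau> permutes {..<n}) \<tau>s ns \<Longrightarrow> sum_perm \<tau>s ns permutes {..<sum_list ns}"
  unfolding sum_perm_def
  by (rule one_line_permutes[OF sum_perm_mset_from[where s = 0, unfolded add_0_left]])

lemma permute_list_block_perm:
  assumes "\<sigma> permutes {..<length xss}"
  shows "permute_list (block_perm \<sigma> (map length xss)) (concat xss) = concat (permute_list \<sigma> xss)"
proof -
  let ?B = "blocks (map length xss)"
  have "length (concat (permute_list \<sigma> ?B)) = length (concat xss)"
    using arg_cong[OF block_perm_mset[of \<sigma> "map length xss"], of size] assms
    by (simp add: length_concat)
  then have "permute_list (block_perm \<sigma> (map length xss)) (concat xss)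
      = concat (map (map ((!) (concat xss))) (permute_list \<sigma> ?B))"
    unfolding block_perm_def by (simp add: permute_list_one_line map_concat)
  also have "map (map ((!) (concat xss))) (permute_list \<sigma> ?B) = permute_list \<sigma> xss"
    using assms by (subst permute_list_map[symmetric]) (simp_all add: map_nth_blocks)
  finally show ?thesis .
qed

lemma permute_list_sum_perm:
  assumes "list_all2 (\<lambda>\<tau> xs. \<tau> permutes {..<length xs}) \<tau>s xss"
  shows "permute_list (sum_perm \<tau>s (map length xss)) (concat xss) = concat (map2 permute_list \<tau>s xss)"
proof -
  let ?B = "blocks (map length xss)"
  have all: "list_all2 (\<lambda>\<tau> n. \<tau> permutes {..<n}) \<tau>s (map length xss)"
    using assms by (simp add: list.rel_map)
  have len: "length \<tau>s = length xss"
    using assms by (rule list_all2_lengthD)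
  have blk: "length (?B ! i) = length (xss ! i)" "map ((!) (concat xss)) (?B ! i) = xss ! i"
    if "i < length xss" for i
  proof -
    show *: "map ((!) (concat xss)) (?B ! i) = xss ! i"
      using arg_cong[OF map_nth_blocks[of xss], of "\<lambda>l. l ! i"] that by simp
    show "length (?B ! i) = length (xss ! i)"
      using arg_cong[OF *, of length] by simp
  qed
  have "length (concat (map2 permute_list \<tau>s ?B)) = length (concat xss)"
    using arg_cong[OF sum_perm_mset_from[OF all, of 0], of size] by (simp add: length_concat)
  then have "permute_list (sum_perm \<tau>s (map length xss)) (concat xss)
      = concat (map (map ((!) (concat xss))) (map2 permute_list \<tau>s ?B))"
    unfolding sum_perm_def by (simp add: permute_list_one_line map_concat)
  also have "map (map ((!) (concat xss))) (map2 permute_list \<tau>s ?B) = map2 permute_list \<tau>s xss"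
    using assms len
    by (intro nth_equalityI) (simp_all add: permute_list_map[symmetric] blk list_all2_conv_all_nth)
  finally show ?thesis .
qed


section \<open>Linear operads\<close>

text \<open>\<open>Ops C n\<close> is the space \<open>C(n)\<close>; the \<^const>\<open>mult\<close> and \<^const>\<open>one\<close> fields of module records
  carry no meaning here. \<open>ocomp C [n\<^sub>1,\<dots>,n\<^sub>k] c [d\<^sub>1,\<dots>,d\<^sub>k]\<close> is \<open>\<gamma>(c; d\<^sub>1,\<dots>,d\<^sub>k)\<close> for
  \<open>c \<in> C(k)\<close>, \<open>d\<^sub>i \<in> C(n\<^sub>i)\<close>, and \<open>osym C n c \<sigma>\<close> is the right action \<open>c \<sigma>\<close> of \<open>\<sigma> \<in> S\<^sub>n\<close> on \<open>C(n)\<close>.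
  Arities are passed explicitly because the carriers of the \<open>C(n)\<close> may overlap.\<close>

record ('k, 'c) operad =
  Ops :: "nat \<Rightarrow> ('k, 'c) module"
  ounit :: 'c
  ocomp :: "nat list \<Rightarrow> 'c \<Rightarrow> 'c list \<Rightarrow> 'c"
  osym :: "nat \<Rightarrow> 'c \<Rightarrow> (nat \<Rightarrow> nat) \<Rightarrow> 'c"

abbreviation opers :: "('k, 'c) operad \<Rightarrow> nat \<Rightarrow> 'c set" where
  "opers C n \<equiv> carrier (Ops C n)"

abbreviation opers_seq :: "('k, 'c) operad \<Rightarrow> 'c list \<Rightarrow> nat list \<Rightarrow> bool" where
  "opers_seq C \<equiv> list_all2 (\<lambda>d n. d \<in> opers C n)"

text \<open>Symmetric unital operads in vector spaces, in May's form. With \<open>\<rho> = \<sigma>\<^sup>-\<^sup>1\<close>, the first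
  equivariance axiom is \<open>\<gamma>(c \<sigma>; d\<^sub>1,\<dots>,d\<^sub>k) = \<gamma>(c; d\<^bsub>\<rho>(1)\<^esub>,\<dots>,d\<^bsub>\<rho>(k)\<^esub>) \<sigma>(n\<^sub>1,\<dots>,n\<^sub>k)\<close>
  after renaming \<open>d\<^sub>i\<close> to \<open>d\<^bsub>\<sigma>(i)\<^esub>\<close>.\<close>

locale linear_operad =
  fixes F :: "('k, 'm) ring_scheme" and C :: "('k, 'c) operad"
  assumes Ops_vectorspace: "vectorspace F (Ops C n)"
    and ounit_closed: "ounit C \<in> opers C 1"
    and ocomp_linear_outer:
      "opers_seq C ds ns \<Longrightarrow>
        linear_map F (Ops C (length ns)) (Ops C (sum_list ns)) (\<lambda>c. ocomp C ns c ds)"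
    and ocomp_linear_inner:
      "\<lbrakk>c \<in> opers C (length (ms @ n # ms')); opers_seq C ds ms; opers_seq C ds' ms'\<rbrakk> \<Longrightarrow>
        linear_map F (Ops C n) (Ops C (sum_list (ms @ n # ms')))
          (\<lambda>d. ocomp C (ms @ n # ms') c (ds @ d # ds'))"
    and ocomp_unit_right:
      "c \<in> opers C n \<Longrightarrow> ocomp C (replicate n 1) c (replicate n (ounit C)) = c"
    and ocomp_unit_left: "d \<in> opers C n \<Longrightarrow> ocomp C [n] (ounit C) [d] = d"
    and ocomp_assoc:
      "\<lbrakk>c \<in> opers C (length ns); opers_seq C ds ns;
        map length mss = ns; list_all2 (opers_seq C) ess mss\<rbrakk> \<Longrightarrow>
        ocomp C (concat mss) (ocomp C ns c ds) (concat ess) =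
        ocomp C (map sum_list mss) c (map (\<lambda>(ms, d, es). ocomp C ms d es) (zip mss (zip ds ess)))"
    and osym_linear: "\<sigma> permutes {..<n} \<Longrightarrow> linear_map F (Ops C n) (Ops C n) (\<lambda>c. osym C n c \<sigma>)"
    and osym_id: "c \<in> opers C n \<Longrightarrow> osym C n c id = c"
    and osym_comp:
      "\<lbrakk>c \<in> opers C n; \<sigma> permutes {..<n}; \<tau> permutes {..<n}\<rbrakk> \<Longrightarrow>
        osym C n (osym C n c \<sigma>) \<tau> = osym C n c (\<sigma> \<circ> \<tau>)"
    and ocomp_equivariant_outer:
      "\<lbrakk>c \<in> opers C (length ns); opers_seq C ds ns; \<sigma> permutes {..<length ns}\<rbrakk> \<Longrightarrow>
        ocomp C (permute_list \<sigma> ns) (osym C (length ns) c \<sigma>) (permute_list \<sigma> ds) =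
        osym C (sum_list ns) (ocomp C ns c ds) (block_perm \<sigma> ns)"
    and ocomp_equivariant_inner:
      "\<lbrakk>c \<in> opers C (length ns); opers_seq C ds ns;
        list_all2 (\<lambda>\<tau> n. \<tau> permutes {..<n}) \<tau>s ns\<rbrakk> \<Longrightarrow>
        ocomp C ns c (map (\<lambda>(n, d, \<tau>). osym C n d \<tau>) (zip ns (zip ds \<tau>s))) =
        osym C (sum_list ns) (ocomp C ns c ds) (sum_perm \<tau>s ns)"


section \<open>Algebras over a linear operad\<close>

text \<open>\<open>opn A n c [a\<^sub>1,\<dots>,a\<^sub>n]\<close> is \<open>\<alpha>\<^sub>n(c)(a\<^sub>1 \<otimes> \<dots> \<otimes> a\<^sub>n)\<close>: linear maps out of \<open>A\<^bsup>\<otimes>n\<^esup>\<close> are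
  represented by multilinear maps, and \<open>n = 0\<close> is allowed. The symmetry axiom is
  \<open>\<alpha>\<^sub>n(c \<sigma>)(a\<^bsub>\<sigma>(1)\<^esub>,\<dots>,a\<^bsub>\<sigma>(n)\<^esub>) = \<alpha>\<^sub>n(c)(a\<^sub>1,\<dots>,a\<^sub>n)\<close>.\<close>

record ('k, 'c, 'a) operad_alg = "('k, 'a) module" +
  opn :: "nat \<Rightarrow> 'c \<Rightarrow> 'a list \<Rightarrow> 'a"

locale operad_algebra = linear_operad F C
  for F :: "('k, 'm) ring_scheme" and C :: "('k, 'c) operad" +
  fixes A :: "('k, 'c, 'a) operad_alg"
  assumes alg_vectorspace: "vectorspace F A"
    and opn_linear:
      "xs \<in> lists (carrier A) \<Longrightarrow> linear_map F (Ops C (length xs)) A (\<lambda>c. opn A (length xs) c xs)"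
    and opn_multilinear:
      "\<lbrakk>c \<in> opers C (length xs + 1 + length ys); xs \<in> lists (carrier A); ys \<in> lists (carrier A)\<rbrakk> \<Longrightarrow>
        linear_map F A A (\<lambda>x. opn A (length xs + 1 + length ys) c (xs @ x # ys))"
    and opn_unit: "a \<in> carrier A \<Longrightarrow> opn A 1 (ounit C) [a] = a"
    and opn_comp:
      "\<lbrakk>c \<in> opers C (length ns); opers_seq C ds ns;
        map length xss = ns; concat xss \<in> lists (carrier A)\<rbrakk> \<Longrightarrow>
        opn A (sum_list ns) (ocomp C ns c ds) (concat xss) =
        opn A (length ns) c (map (\<lambda>(n, d, xs). opn A n d xs) (zip ns (zip ds xss)))"
    and opn_sym:
      "\<lbrakk>c \<in> opers C (length xs); xs \<in> lists (carrier A); \<sigma> permutes {..<length xs}\<rbrakk> \<Longrightarrow>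
        opn A (length xs) (osym C (length xs) c \<sigma>) (permute_list \<sigma> xs) = opn A (length xs) c xs"

definition alg_hom ::
  "('k, 'm) ring_scheme \<Rightarrow> ('k, 'c) operad \<Rightarrow> ('k, 'c, 'a) operad_alg \<Rightarrow> ('k, 'c, 'b) operad_alg
    \<Rightarrow> ('a \<Rightarrow> 'b) set" where
  "alg_hom F C A B = {f. linear_map F A B f \<and>
     (\<forall>n. \<forall>c\<in>opers C n. \<forall>xs\<in>lists (carrier A). length xs = n \<longrightarrow>
        f (opn A n c xs) = opn B n c (map f xs))}"

definition alg_iso ::
  "('k, 'm) ring_scheme \<Rightarrow> ('k, 'c) operad \<Rightarrow> ('k, 'c, 'a) operad_alg \<Rightarrow> ('k, 'c, 'b) operad_alg
    \<Rightarrow> ('a \<Rightarrow> 'b) set" where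
  "alg_iso F C A B = {f \<in> alg_hom F C A B. bij_betw f (carrier A) (carrier B)}"

definition alg_Aut ::
  "('k, 'm) ring_scheme \<Rightarrow> ('k, 'c) operad \<Rightarrow> ('k, 'c, 'a) operad_alg \<Rightarrow> ('a \<Rightarrow> 'a) monoid" where
  "alg_Aut F C A = BijGroup (carrier A) \<lparr>carrier := alg_hom F C A A \<inter> Bij (carrier A)\<rparr>"

text \<open>\<open>End\<^sub>F(A)\<close>; endomorphisms are taken extensional on \<open>carrier A\<close>, so that equality is equality
  of maps on \<open>carrier A\<close>.\<close>

definition End_vs :: "('k, 'm) ring_scheme \<Rightarrow> ('k, 'a, 'z) module_scheme \<Rightarrow> ('k, 'a \<Rightarrow> 'a) module" where
  "End_vs F A =
    \<lparr>carrier = {f \<in> extensional (carrier A). linear_map F A A f},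
     mult = (\<lambda>f g. compose (carrier A) f g),
     one = (\<lambda>x\<in>carrier A. x),
     zero = (\<lambda>x\<in>carrier A. \<zero>\<^bsub>A\<^esub>),
     add = (\<lambda>f g. \<lambda>x\<in>carrier A. f x \<oplus>\<^bsub>A\<^esub> g x),
     smult = (\<lambda>k f. \<lambda>x\<in>carrier A. k \<odot>\<^bsub>A\<^esub> f x)\<rparr>"

text \<open>The space \<open>E\<^sub>A\<close>.\<close>

definition E_space ::
  "('k, 'm) ring_scheme \<Rightarrow> ('k, 'c) operad \<Rightarrow> ('k, 'c, 'a) operad_alg \<Rightarrow> ('a \<Rightarrow> 'a) set" where
  "E_space F C A = module.span F (End_vs F A)
     {(\<lambda>x\<in>carrier A. opn A n c (xs @ x # ys)) | n c xs ys.
        n \<ge> 2 \<and> c \<in> opers C n \<and> xs \<in> lists (carrier A) \<and> ys \<in> lists (carrier A) \<and>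
        length xs + 1 + length ys = n}"

text \<open>Since \<open>I\<close> is a subspace, it suffices to test pure tensors
  \<open>T = a\<^sub>1 \<otimes> \<dots> \<otimes> a\<^bsub>j-1\<^esub> \<otimes> x \<otimes> a\<^bsub>j+1\<^esub> \<otimes> \<dots> \<otimes> a\<^sub>n\<close> with \<open>x \<in> I\<close>.\<close>

definition alg_ideal ::
  "('k, 'm) ring_scheme \<Rightarrow> ('k, 'c) operad \<Rightarrow> ('k, 'c, 'a) operad_alg \<Rightarrow> 'a set \<Rightarrow> bool" where
  "alg_ideal F C A I \<longleftrightarrow> VectorSpace.subspace F I A \<and>
     (\<forall>n\<ge>1. \<forall>c\<in>opers C n. \<forall>xs\<in>lists (carrier A). \<forall>x\<in>I. \<forall>ys\<in>lists (carrier A).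
        length xs + 1 + length ys = n \<longrightarrow> opn A n c (xs @ x # ys) \<in> I)"

definition simple_algebra ::
  "('k, 'm) ring_scheme \<Rightarrow> ('k, 'c) operad \<Rightarrow> ('k, 'c, 'a) operad_alg \<Rightarrow> bool" where
  "simple_algebra F C B \<longleftrightarrow>
     operad_algebra F C B \<and> vectorspace.fin_dim F B \<and>
     (\<forall>I. alg_ideal F C B I \<longrightarrow> I = {\<zero>\<^bsub>B\<^esub>} \<or> I = carrier B) \<and>
     E_space F C B \<noteq> {\<zero>\<^bsub>End_vs F B\<^esub>}"


section \<open>Equivariant algebras\<close>

definition equivariant_algebra ::
  "('k, 'm) ring_scheme \<Rightarrow> ('k, 'c) operad \<Rightarrow> ('g, 'n) monoid_scheme \<Rightarrow>
    ('k, 'c, 'a) operad_alg \<Rightarrow> ('g \<Rightarrow> 'a \<Rightarrow> 'a) \<Rightarrow> bool" where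
  "equivariant_algebra F C G A \<rho> \<longleftrightarrow> operad_algebra F C A \<and> \<rho> \<in> hom G (alg_Aut F C A)"

definition simple_equivariant_algebra ::
  "('k, 'm) ring_scheme \<Rightarrow> ('k, 'c) operad \<Rightarrow> ('g, 'n) monoid_scheme \<Rightarrow>
    ('k, 'c, 'a) operad_alg \<Rightarrow> ('g \<Rightarrow> 'a \<Rightarrow> 'a) \<Rightarrow> bool" where
  "simple_equivariant_algebra F C G A \<rho> \<longleftrightarrow>
     equivariant_algebra F C G A \<rho> \<and> vectorspace.fin_dim F A \<and>
     (\<forall>I. alg_ideal F C A I \<and> (\<forall>g\<in>carrier G. \<forall>x\<in>I. \<rho> g x \<in> I) \<longrightarrow>
        I = {\<zero>\<^bsub>A\<^esub>} \<or> I = carrier A) \<and>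
     E_space F C A \<noteq> {\<zero>\<^bsub>End_vs F A\<^esub>}"

definition equivariant_iso ::
  "('k, 'm) ring_scheme \<Rightarrow> ('k, 'c) operad \<Rightarrow> ('g, 'n) monoid_scheme \<Rightarrow>
    ('k, 'c, 'a) operad_alg \<Rightarrow> ('g \<Rightarrow> 'a \<Rightarrow> 'a) \<Rightarrow>
    ('k, 'c, 'b) operad_alg \<Rightarrow> ('g \<Rightarrow> 'b \<Rightarrow> 'b) \<Rightarrow> ('a \<Rightarrow> 'b) set" where
  "equivariant_iso F C G A \<rho> A' \<rho>' =
     {f \<in> alg_iso F C A A'. \<forall>g\<in>carrier G. \<forall>a\<in>carrier A. f (\<rho> g a) = \<rho>' g (f a)}"

text \<open>\<open>Fun\<^sub>H(G,B)\<close>, with functions on \<open>G\<close> extensional on \<open>carrier G\<close>. The fields \<^const>\<open>mult\<close> and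
  \<^const>\<open>one\<close> are irrelevant.\<close>

definition Fun_alg ::
  "('g, 'n) monoid_scheme \<Rightarrow> 'g set \<Rightarrow> ('k, 'c, 'b) operad_alg \<Rightarrow> ('g \<Rightarrow> 'b \<Rightarrow> 'b) \<Rightarrow>
    ('k, 'c, 'g \<Rightarrow> 'b) operad_alg" where
  "Fun_alg G H B \<phi> =
    \<lparr>carrier = {f \<in> carrier G \<rightarrow>\<^sub>E carrier B. \<forall>h\<in>H. \<forall>x\<in>carrier G. f (h \<otimes>\<^bsub>G\<^esub> x) = \<phi> h (f x)},
     mult = undefined,
     one = undefined,
     zero = (\<lambda>x\<in>carrier G. \<zero>\<^bsub>B\<^esub>),
     add = (\<lambda>f f'. \<lambda>x\<in>carrier G. f x \<oplus>\<^bsub>B\<^esub> f' x),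
     smult = (\<lambda>k f. \<lambda>x\<in>carrier G. k \<odot>\<^bsub>B\<^esub> f x),
     opn = (\<lambda>n c fs. \<lambda>x\<in>carrier G. opn B n c (map (\<lambda>f. f x) fs))\<rparr>"

definition Fun_action ::
  "('g, 'n) monoid_scheme \<Rightarrow> 'g set \<Rightarrow> ('k, 'c, 'b) operad_alg \<Rightarrow> ('g \<Rightarrow> 'b \<Rightarrow> 'b) \<Rightarrow>
    'g \<Rightarrow> ('g \<Rightarrow> 'b) \<Rightarrow> ('g \<Rightarrow> 'b)" where
  "Fun_action G H B \<phi> = (\<lambda>g. \<lambda>f\<in>carrier (Fun_alg G H B \<phi>). \<lambda>x\<in>carrier G. f (x \<otimes>\<^bsub>G\<^esub> g))"

text \<open>\<open>(H, B, \<phi>)\<close> presents \<open>A\<close>, i.e. \<open>A = Fun\<^sub>H(G,B)\<close> as \<open>G\<close>-equivariant \<open>C\<close>-algebras.\<close>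

definition induced_presentation ::
  "('k, 'm) ring_scheme \<Rightarrow> ('k, 'c) operad \<Rightarrow> ('g, 'n) monoid_scheme \<Rightarrow>
    ('k, 'c, 'a) operad_alg \<Rightarrow> ('g \<Rightarrow> 'a \<Rightarrow> 'a) \<Rightarrow>
    'g set \<Rightarrow> ('k, 'c, 'b) operad_alg \<Rightarrow> ('g \<Rightarrow> 'b \<Rightarrow> 'b) \<Rightarrow> bool" where
  "induced_presentation F C G A \<rho> H B \<phi> \<longleftrightarrow>
     subgroup H G \<and> simple_algebra F C B \<and> \<phi> \<in> hom (G\<lparr>carrier := H\<rparr>) (alg_Aut F C B) \<and>
     equivariant_iso F C G A \<rho> (Fun_alg G H B \<phi>) (Fun_action G H B \<phi>) \<noteq> {}"

end

theory Submission
  imports Defs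
begin

text \<open>
  A simple equivariant algebra is a product of simple algebras that \<open>G\<close> permutes transitively; \<open>B\<close> is
  one factor and \<open>H\<close> its stabilizer. The factors are seen through the maximal ideals. Let \<open>M\<close> be a
  maximal ideal of \<open>A\<close>. Its translates intersect in an invariant proper ideal, hence in zero, and
  since \<open>E\<^sub>A \<noteq> 0\<close> some operation of arity at least two has a value outside \<open>M\<close>
  (\<open>simple_equivariant_cosimple_ideal_exists\<close>). Put \<open>B = A / M\<close> with projection \<open>p\<close>, and let \<open>H\<close> be
  the stabilizer of \<open>M\<close>. The map \<open>a \<mapsto> (x \<mapsto> p(xa))\<close> from \<open>A\<close> to \<open>Fun\<^sub>H(G,B)\<close> is injective because the
  translates of \<open>M\<close> intersect in zero, and surjective by the Chinese remainder theorem
  (\<open>cosimple_ideals_remainder\<close>).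

  There is no product on \<open>A\<close>, but the operations of arity at least two do its work: a maximal ideal
  that misses one of their values is prime with respect to intersections of ideals
  (\<open>cosimple_ideal_prime\<close>). Both the remainder theorem and uniqueness follow from this. For
  uniqueness, a presentation \<open>A = Fun\<^sub>H(G,B)\<close> is recorded by the evaluation \<open>p : A \<rightarrow> B\<close> at \<open>1\<close>, from
  which \<open>H\<close> is recovered as the stabilizer of the kernel and \<open>\<phi>\<close> as the induced action
  (\<open>induced_quotient_if_presentation\<close>). The translates of this kernel intersect in zero, so
  primality puts one of them inside the kernel that belongs to any other presentation, and maximality
  makes the two equal. Hence the kernels of two presentations are conjugate, and with them the groups
  \<open>H\<close> and the homomorphisms \<open>\<phi>\<close>.
\<close>

section \<open>Linear maps and algebra homomorphisms\<close>

lemma linear_mapI: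
  assumes "vectorspace F V" "vectorspace F W"
    and "\<And>x. x \<in> carrier V \<Longrightarrow> f x \<in> carrier W"
    and "\<And>x y. \<lbrakk>x \<in> carrier V; y \<in> carrier V\<rbrakk> \<Longrightarrow> f (x \<oplus>\<^bsub>V\<^esub> y) = f x \<oplus>\<^bsub>W\<^esub> f y"
    and "\<And>k x. \<lbrakk>k \<in> carrier F; x \<in> carrier V\<rbrakk> \<Longrightarrow> f (k \<odot>\<^bsub>V\<^esub> x) = k \<odot>\<^bsub>W\<^esub> f x"
  shows "linear_map F V W f"
proof -
  have "f \<in> module_hom F V W"
    using assms(3-5) by (auto simp: module_hom_def)
  then show ?thesis
    using assms(1,2)
    by (intro linear_map.intro mod_hom.intro mod_hom_axioms.intro) (auto simp: vectorspace_def)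
qed

lemma linear_mapD:
  assumes "linear_map F V W f"
  shows "vectorspace F V" "vectorspace F W"
    and "x \<in> carrier V \<Longrightarrow> f x \<in> carrier W"
    and "\<lbrakk>x \<in> carrier V; y \<in> carrier V\<rbrakk> \<Longrightarrow> f (x \<oplus>\<^bsub>V\<^esub> y) = f x \<oplus>\<^bsub>W\<^esub> f y"
    and "\<lbrakk>k \<in> carrier F; x \<in> carrier V\<rbrakk> \<Longrightarrow> f (k \<odot>\<^bsub>V\<^esub> x) = k \<odot>\<^bsub>W\<^esub> f x"
    and "f \<zero>\<^bsub>V\<^esub> = \<zero>\<^bsub>W\<^esub>"
    and "\<lbrakk>x \<in> carrier V; y \<in> carrier V\<rbrakk> \<Longrightarrow> f (x \<ominus>\<^bsub>V\<^esub> y) = f x \<ominus>\<^bsub>W\<^esub> f y"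
proof -
  interpret linear_map F V W f by (rule assms)
  show "vectorspace F V" "vectorspace F W"
    using assms by (simp_all add: linear_map_def)
  show "x \<in> carrier V \<Longrightarrow> f x \<in> carrier W"
    "\<lbrakk>x \<in> carrier V; y \<in> carrier V\<rbrakk> \<Longrightarrow> f (x \<oplus>\<^bsub>V\<^esub> y) = f x \<oplus>\<^bsub>W\<^esub> f y"
    "\<lbrakk>k \<in> carrier F; x \<in> carrier V\<rbrakk> \<Longrightarrow> f (k \<odot>\<^bsub>V\<^esub> x) = k \<odot>\<^bsub>W\<^esub> f x"
    "f \<zero>\<^bsub>V\<^esub> = \<zero>\<^bsub>W\<^esub>"
    "\<lbrakk>x \<in> carrier V; y \<in> carrier V\<rbrakk> \<Longrightarrow> f (x \<ominus>\<^bsub>V\<^esub> y) = f x \<ominus>\<^bsub>W\<^esub> f y"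
    by (simp_all only: T_im T_add T_smult f0_is_0 f_minus)
qed

text \<open>The vector space axioms other than closure are equations and the existence of negatives, so they
  pass to the image of any map that respects the operations.\<close>

lemma vectorspace_surj_image:
  fixes B :: "('k, 'b, 'z) module_scheme"
  assumes V: "vectorspace F V" and surj: "p ` carrier V = carrier B"
    and zero: "p \<zero>\<^bsub>V\<^esub> = \<zero>\<^bsub>B\<^esub>"
    and add: "\<And>x y. \<lbrakk>x \<in> carrier V; y \<in> carrier V\<rbrakk> \<Longrightarrow> p (x \<oplus>\<^bsub>V\<^esub> y) = p x \<oplus>\<^bsub>B\<^esub> p y"
    and smult: "\<And>k x. \<lbrakk>k \<in> carrier F; x \<in> carrier V\<rbrakk> \<Longrightarrow> p (k \<odot>\<^bsub>V\<^esub> x) = k \<odot>\<^bsub>B\<^esub> p x"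
  shows "vectorspace F B"
proof -
  interpret V: vectorspace F V by (rule V)
  have B: "\<exists>x\<in>carrier V. b = p x" if "b \<in> carrier B" for b
    using that surj by blast
  have im [simp]: "p x \<in> carrier B" if "x \<in> carrier V" for x
    using that surj by blast
  have "abelian_group B"
  proof (rule abelian_groupI)
    show "x \<oplus>\<^bsub>B\<^esub> y \<in> carrier B" if "x \<in> carrier B" "y \<in> carrier B" for x y
      using that[THEN B] by (auto simp flip: add)
    show "\<zero>\<^bsub>B\<^esub> \<in> carrier B" by (simp flip: zero)
    show "x \<oplus>\<^bsub>B\<^esub> y \<oplus>\<^bsub>B\<^esub> z = x \<oplus>\<^bsub>B\<^esub> (y \<oplus>\<^bsub>B\<^esub> z)"
      if "x \<in> carrier B" "y \<in> carrier B" "z \<in> carrier B" for x y z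
      using that[THEN B] by (auto simp: V.a_assoc simp flip: add)
    show "x \<oplus>\<^bsub>B\<^esub> y = y \<oplus>\<^bsub>B\<^esub> x" if "x \<in> carrier B" "y \<in> carrier B" for x y
      using that[THEN B] by (auto simp: V.a_comm simp flip: add)
    show "\<zero>\<^bsub>B\<^esub> \<oplus>\<^bsub>B\<^esub> x = x" if "x \<in> carrier B" for x
      using B[OF that] by (auto simp flip: add zero)
    show "\<exists>y\<in>carrier B. y \<oplus>\<^bsub>B\<^esub> x = \<zero>\<^bsub>B\<^esub>" if x: "x \<in> carrier B" for x
    proof -
      obtain a where a: "a \<in> carrier V" "x = p a" using B[OF x] by blast
      then have "p (\<ominus>\<^bsub>V\<^esub> a) \<oplus>\<^bsub>B\<^esub> x = \<zero>\<^bsub>B\<^esub>"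
        by (simp add: V.l_neg flip: add zero)
      then show ?thesis using a by (intro bexI[of _ "p (\<ominus>\<^bsub>V\<^esub> a)"]) simp_all
    qed
  qed
  moreover have "cring F" by (rule V.R.is_cring)
  ultimately have "module F B"
  proof (intro moduleI)
    show "k \<odot>\<^bsub>B\<^esub> x \<in> carrier B" if "k \<in> carrier F" "x \<in> carrier B" for k x
      using B[OF that(2)] that(1) by (auto simp flip: smult)
    show "(k \<oplus>\<^bsub>F\<^esub> l) \<odot>\<^bsub>B\<^esub> x = k \<odot>\<^bsub>B\<^esub> x \<oplus>\<^bsub>B\<^esub> l \<odot>\<^bsub>B\<^esub> x"
      if "k \<in> carrier F" "l \<in> carrier F" "x \<in> carrier B" for k l x
      using B[OF that(3)] that(1,2) by (auto simp: V.smult_l_distr simp flip: smult add)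
    show "k \<odot>\<^bsub>B\<^esub> (x \<oplus>\<^bsub>B\<^esub> y) = k \<odot>\<^bsub>B\<^esub> x \<oplus>\<^bsub>B\<^esub> k \<odot>\<^bsub>B\<^esub> y"
      if "k \<in> carrier F" "x \<in> carrier B" "y \<in> carrier B" for k x y
      using that(2,3)[THEN B] that(1) by (auto simp: V.smult_r_distr simp flip: smult add)
    show "(k \<otimes>\<^bsub>F\<^esub> l) \<odot>\<^bsub>B\<^esub> x = k \<odot>\<^bsub>B\<^esub> (l \<odot>\<^bsub>B\<^esub> x)"
      if "k \<in> carrier F" "l \<in> carrier F" "x \<in> carrier B" for k l x
      using B[OF that(3)] that(1,2) by (auto simp: V.smult_assoc1 simp flip: smult)
    show "\<one>\<^bsub>F\<^esub> \<odot>\<^bsub>B\<^esub> x = x" if "x \<in> carrier B" for x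
      using B[OF that] by (auto simp flip: smult)
  qed auto
  then show ?thesis
    using V by (simp add: vectorspace_def)
qed

sublocale operad_algebra \<subseteq> alg: vectorspace F A
  by (rule alg_vectorspace)

context operad_algebra
begin

lemma opn_closed:
  "\<lbrakk>c \<in> opers C n; xs \<in> lists (carrier A); length xs = n\<rbrakk> \<Longrightarrow> opn A n c xs \<in> carrier A"
  using linear_mapD(3)[OF opn_linear] by blast

lemma opn_slot:
  assumes "c \<in> opers C n" "xs \<in> lists (carrier A)" "ys \<in> lists (carrier A)"
    "length xs + 1 + length ys = n"
  shows "linear_map F A A (\<lambda>x. opn A n c (xs @ x # ys))"
  using opn_multilinear[of c xs ys] assms by simp

text \<open>An image of an algebra is an algebra because every axiom is an identity between values of
  operations. This saves checking the axioms for quotients and for algebras of functions: it is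
  enough to exhibit a surjection onto them that respects the operations.\<close>

lemma operad_algebra_surj_image:
  fixes B :: "('k, 'c, 'b) operad_alg"
  assumes surj: "p ` carrier A = carrier B"
    and zero: "p \<zero>\<^bsub>A\<^esub> = \<zero>\<^bsub>B\<^esub>"
    and add: "\<And>x y. \<lbrakk>x \<in> carrier A; y \<in> carrier A\<rbrakk> \<Longrightarrow> p (x \<oplus>\<^bsub>A\<^esub> y) = p x \<oplus>\<^bsub>B\<^esub> p y"
    and smult: "\<And>k x. \<lbrakk>k \<in> carrier F; x \<in> carrier A\<rbrakk> \<Longrightarrow> p (k \<odot>\<^bsub>A\<^esub> x) = k \<odot>\<^bsub>B\<^esub> p x"
    and opn: "\<And>n c xs. \<lbrakk>c \<in> opers C n; xs \<in> lists (carrier A); length xs = n\<rbrakk> \<Longrightarrow>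
      p (opn A n c xs) = opn B n c (map p xs)"
  shows "operad_algebra F C B" and "p \<in> alg_hom F C A B"
proof -
  have B: "vectorspace F B"
    by (rule vectorspace_surj_image[OF alg_vectorspace surj zero add smult])
  have p: "linear_map F A B p"
    using surj by (intro linear_mapI alg_vectorspace B add smult) auto
  then show "p \<in> alg_hom F C A B"
    by (auto simp: alg_hom_def opn)
  have lift: "\<exists>as\<in>lists (carrier A). xs = map p as" if "xs \<in> lists (carrier B)" for xs
    using that unfolding surj[symmetric] lists_image by blast
  show "operad_algebra F C B"
  proof (intro operad_algebra.intro operad_algebra_axioms.intro B linear_operad_axioms)
    fix xs assume "xs \<in> lists (carrier B)"
    then obtain as where as: "as \<in> lists (carrier A)" "xs = map p as" using lift by blast
    note lin = opn_linear[OF as(1)]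
    show "linear_map F (Ops C (length xs)) B (\<lambda>c. opn B (length xs) c xs)"
    proof (rule linear_mapI[OF Ops_vectorspace B])
      fix c d assume cd: "c \<in> opers C (length xs)" "d \<in> opers C (length xs)"
      interpret Ops: vectorspace F "Ops C (length xs)" by (rule Ops_vectorspace)
      show "opn B (length xs) c xs \<in> carrier B"
        using cd(1) as linear_mapD(3)[OF p opn_closed] by (simp flip: opn)
      have "c \<oplus>\<^bsub>Ops C (length xs)\<^esub> d \<in> opers C (length xs)" using cd by simp
      then show "opn B (length xs) (c \<oplus>\<^bsub>Ops C (length xs)\<^esub> d) xs =
          opn B (length xs) c xs \<oplus>\<^bsub>B\<^esub> opn B (length xs) d xs"
        using cd as linear_mapD(4)[OF lin] by (simp add: opn_closed flip: opn add)
    next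
      fix k c assume kc: "k \<in> carrier F" "c \<in> opers C (length xs)"
      interpret Ops: vectorspace F "Ops C (length xs)" by (rule Ops_vectorspace)
      have "k \<odot>\<^bsub>Ops C (length xs)\<^esub> c \<in> opers C (length xs)" using kc by simp
      then show "opn B (length xs) (k \<odot>\<^bsub>Ops C (length xs)\<^esub> c) xs = k \<odot>\<^bsub>B\<^esub> opn B (length xs) c xs"
        using kc as linear_mapD(5)[OF lin] by (simp add: opn_closed flip: opn smult)
    qed
  next
    fix c xs ys
    assume c: "c \<in> opers C (length xs + 1 + length ys)"
      and xs: "xs \<in> lists (carrier B)" and ys: "ys \<in> lists (carrier B)"
    obtain as bs where as: "as \<in> lists (carrier A)" "xs = map p as"
      and bs: "bs \<in> lists (carrier A)" "ys = map p bs"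
      using lift[OF xs] lift[OF ys] by (elim bexE)
    let ?n = "length xs + 1 + length ys"
    have lin: "linear_map F A A (\<lambda>a. opn A ?n c (as @ a # bs))"
      using c as bs by (intro opn_slot) simp_all
    have eq: "opn B ?n c (xs @ p a # ys) = p (opn A ?n c (as @ a # bs))"
      if "a \<in> carrier A" for a
      using that c as bs by (subst opn) auto
    show "linear_map F B B (\<lambda>x. opn B ?n c (xs @ x # ys))"
    proof (rule linear_mapI[OF B B]; unfold surj[symmetric]; elim imageE; hypsubst)
      fix a assume a: "a \<in> carrier A"
      show "opn B ?n c (xs @ p a # ys) \<in> p ` carrier A"
        unfolding eq[OF a] using linear_mapD(3)[OF lin a] by blast
    next
      fix a b assume ab: "a \<in> carrier A" "b \<in> carrier A"
      show "opn B ?n c (xs @ (p a \<oplus>\<^bsub>B\<^esub> p b) # ys) =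
          opn B ?n c (xs @ p a # ys) \<oplus>\<^bsub>B\<^esub> opn B ?n c (xs @ p b # ys)"
        using ab linear_mapD(3,4)[OF lin] by (simp only: eq alg.a_closed flip: add)
    next
      fix k a assume ka: "k \<in> carrier F" "a \<in> carrier A"
      show "opn B ?n c (xs @ (k \<odot>\<^bsub>B\<^esub> p a) # ys) = k \<odot>\<^bsub>B\<^esub> opn B ?n c (xs @ p a # ys)"
        using ka linear_mapD(3,5)[OF lin] by (simp only: eq alg.smult_closed flip: smult)
    qed
  next
    fix b assume "b \<in> carrier B"
    then obtain a where a: "a \<in> carrier A" "b = p a" using surj by blast
    show "opn B 1 (ounit C) [b] = b"
      using opn[OF ounit_closed, of "[a]"] opn_unit[OF a(1)] a by simp
  next
    fix c ns ds and xss :: "'b list list"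
    assume c: "c \<in> opers C (length ns)" and ds: "opers_seq C ds ns"
      and len: "map length xss = ns" and "concat xss \<in> lists (carrier B)"
    then have "xss \<in> lists (lists (carrier B))" by auto
    then obtain yss where yss: "yss \<in> lists (lists (carrier A))" "xss = map (map p) yss"
      unfolding surj[symmetric] lists_image by blast
    have c': "ocomp C ns c ds \<in> opers C (sum_list ns)"
      using linear_mapD(3)[OF ocomp_linear_outer[OF ds] c] .
    have len': "map length yss = ns"
      using len yss(2) by (simp add: comp_def)
    have cl: "concat yss \<in> lists (carrier A)" using yss(1) by (auto simp: in_lists_conv_set)
    have l: "length yss = length ns" "length ds = length ns"
      using len' ds by (auto dest: list_all2_lengthD)
    have inner: "(\<lambda>(n, d, xs). opn A n d xs) z \<in> carrier A \<and>
        p ((\<lambda>(n, d, xs). opn A n d xs) z) = (\<lambda>(n, d, xs). opn B n d (map p xs)) z"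
      if z: "z \<in> set (zip ns (zip ds yss))" for z
    proof -
      obtain i where i: "i < length ns" "z = (ns ! i, ds ! i, yss ! i)"
        using z l by (fastforce simp: in_set_conv_nth)
      have *: "ds ! i \<in> opers C (ns ! i)" "yss ! i \<in> lists (carrier A)" "length (yss ! i) = ns ! i"
        using list_all2_nthD2[OF ds i(1)] yss(1) i(1) l(1) nth_map[of i yss length]
        by (auto simp: len' in_lists_conv_set)
      show ?thesis
        unfolding i(2) by (simp add: opn[OF *] opn_closed[OF *])
    qed
    have "opn B (sum_list ns) (ocomp C ns c ds) (concat xss)
        = p (opn A (sum_list ns) (ocomp C ns c ds) (concat yss))"
      using c' cl len' yss(2) by (subst opn) (auto simp: length_concat map_concat)
    also have "\<dots> = p (opn A (length ns) c (map (\<lambda>(n, d, xs). opn A n d xs) (zip ns (zip ds yss))))"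
      using opn_comp[OF c ds len' cl] by simp
    also have "\<dots> = opn B (length ns) c (map p (map (\<lambda>(n, d, xs). opn A n d xs) (zip ns (zip ds yss))))"
      using c l inner by (intro opn) auto
    also have "map p (map (\<lambda>(n, d, xs). opn A n d xs) (zip ns (zip ds yss)))
        = map (\<lambda>(n, d, xs). opn B n d (map p xs)) (zip ns (zip ds yss))"
      using inner by simp
    also have "\<dots> = map (\<lambda>(n, d, xs). opn B n d xs) (zip ns (zip ds xss))"
      using l yss(2) by (intro nth_equalityI) simp_all
    finally show "opn B (sum_list ns) (ocomp C ns c ds) (concat xss)
        = opn B (length ns) c (map (\<lambda>(n, d, xs). opn B n d xs) (zip ns (zip ds xss)))" .
  next
    fix c \<sigma> and xs :: "'b list"
    assume c: "c \<in> opers C (length xs)" and "xs \<in> lists (carrier B)"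
      and \<sigma>: "\<sigma> permutes {..<length xs}"
    then obtain as where as: "as \<in> lists (carrier A)" "xs = map p as" using lift by blast
    have perm: "permute_list \<sigma> as \<in> lists (carrier A)"
      using as \<sigma> by auto
    have \<sigma>': "\<sigma> permutes {..<length as}" and len: "length xs = length as"
      using as \<sigma> by simp_all
    have "osym C (length as) c \<sigma> \<in> opers C (length as)"
      using linear_mapD(3)[OF osym_linear[OF \<sigma>]] c len by simp
    then have "opn B (length xs) (osym C (length xs) c \<sigma>) (permute_list \<sigma> xs)
        = p (opn A (length as) (osym C (length as) c \<sigma>) (permute_list \<sigma> as))"
      by (simp add: as(2) permute_list_map[OF \<sigma>'] opn[OF _ perm])
    also have "\<dots> = p (opn A (length as) c as)"
      using opn_sym[OF _ as(1) \<sigma>', of c] c len by simp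
    also have "\<dots> = opn B (length xs) c xs"
      using opn[OF _ as(1) refl, of c] c len as(2) by simp
    finally show "opn B (length xs) (osym C (length xs) c \<sigma>) (permute_list \<sigma> xs) = opn B (length xs) c xs" .
  qed
qed

end

lemma alg_homD:
  assumes "f \<in> alg_hom F C A B"
  shows "linear_map F A B f"
    and "\<lbrakk>c \<in> opers C n; xs \<in> lists (carrier A); length xs = n\<rbrakk> \<Longrightarrow>
      f (opn A n c xs) = opn B n c (map f xs)"
  using assms by (auto simp: alg_hom_def)

lemma alg_homI:
  assumes "linear_map F A B f"
    and "\<And>n c xs. \<lbrakk>c \<in> opers C n; xs \<in> lists (carrier A); length xs = n\<rbrakk> \<Longrightarrow>
      f (opn A n c xs) = opn B n c (map f xs)"
  shows "f \<in> alg_hom F C A B"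
  using assms by (auto simp: alg_hom_def)

lemma alg_hom_comp:
  assumes f: "f \<in> alg_hom F C A B" and g: "g \<in> alg_hom F C B D"
  shows "(\<lambda>x. g (f x)) \<in> alg_hom F C A D"
proof (rule alg_homI)
  note f' = linear_mapD[OF alg_homD(1)[OF f]] and g' = linear_mapD[OF alg_homD(1)[OF g]]
  show "linear_map F A D (\<lambda>x. g (f x))"
    by (rule linear_mapI) (simp_all add: f' g')
  show "g (f (opn A n c xs)) = opn D n c (map (\<lambda>x. g (f x)) xs)"
    if "c \<in> opers C n" "xs \<in> lists (carrier A)" "length xs = n" for n c xs
  proof -
    have "map f xs \<in> lists (carrier B)" using that(2) f'(3) by auto
    then show ?thesis
      using that by (simp add: alg_homD(2)[OF f] alg_homD(2)[OF g] comp_def)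
  qed
qed

lemma (in abelian_group) minus_eq_zero_iff:
  "\<lbrakk>x \<in> carrier G; y \<in> carrier G\<rbrakk> \<Longrightarrow> x \<ominus> y = \<zero> \<longleftrightarrow> x = y"
  using minus_equality[of x "\<ominus> y"] by (auto simp: minus_eq r_neg)

text \<open>The first isomorphism theorem in a form without quotients: two epimorphisms from \<open>A\<close> with the
  same kernel differ by an isomorphism of their targets. It produces both the action of a stabilizer
  on a quotient and the comparison of two presentations.\<close>

lemma alg_iso_from_equal_kernels:
  assumes opn: "\<And>n c xs. \<lbrakk>c \<in> opers C n; xs \<in> lists (carrier A); length xs = n\<rbrakk> \<Longrightarrow>
      opn A n c xs \<in> carrier A"
    and p: "p \<in> alg_hom F C A B" and p_surj: "p ` carrier A = carrier B"
    and q: "q \<in> alg_hom F C A B'" and q_surj: "q ` carrier A = carrier B'"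
    and ker: "\<And>a. a \<in> carrier A \<Longrightarrow> p a = \<zero>\<^bsub>B\<^esub> \<longleftrightarrow> q a = \<zero>\<^bsub>B'\<^esub>"
  shows "\<exists>\<psi>\<in>alg_iso F C B B'. \<forall>a\<in>carrier A. \<psi> (p a) = q a"
proof -
  note p' = linear_mapD[OF alg_homD(1)[OF p]] and q' = linear_mapD[OF alg_homD(1)[OF q]]
  interpret A: vectorspace F A by (rule p'(1))
  interpret B: vectorspace F B by (rule p'(2))
  interpret B': vectorspace F B' by (rule q'(2))
  have eq: "p a = p b \<longleftrightarrow> q a = q b" if ab: "a \<in> carrier A" "b \<in> carrier A" for a b
    using ab ker[of "a \<ominus>\<^bsub>A\<^esub> b"] by (simp add: p' q' B.minus_eq_zero_iff B'.minus_eq_zero_iff)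
  define \<psi> where "\<psi> b = q (inv_into (carrier A) p b)" for b
  have \<psi>: "\<psi> (p a) = q a" if "a \<in> carrier A" for a
  proof -
    have "inv_into (carrier A) p (p a) \<in> carrier A" "p (inv_into (carrier A) p (p a)) = p a"
      using that by (auto intro: inv_into_into f_inv_into_f)
    then show ?thesis using eq that by (simp add: \<psi>_def)
  qed
  have "inj_on \<psi> (carrier B)"
    unfolding p_surj[symmetric] inj_on_def by (auto simp: \<psi> eq)
  moreover have "\<psi> ` carrier B = carrier B'"
    unfolding p_surj[symmetric] q_surj[symmetric] image_image
    by (rule image_cong[OF refl \<psi>])
  moreover have "\<psi> \<in> alg_hom F C B B'"
  proof (rule alg_homI, rule linear_mapI[OF p'(2) q'(2)])
    have B: "\<exists>a\<in>carrier A. b = p a" if "b \<in> carrier B" for b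
      using that p_surj by blast
    show "\<psi> x \<in> carrier B'" if "x \<in> carrier B" for x
      using B[OF that] by (auto simp: \<psi> q')
    show "\<psi> (x \<oplus>\<^bsub>B\<^esub> y) = \<psi> x \<oplus>\<^bsub>B'\<^esub> \<psi> y" if "x \<in> carrier B" "y \<in> carrier B" for x y
      using that[THEN B] by (auto simp: \<psi> q' simp flip: p'(4))
    show "\<psi> (k \<odot>\<^bsub>B\<^esub> x) = k \<odot>\<^bsub>B'\<^esub> \<psi> x" if "k \<in> carrier F" "x \<in> carrier B" for k x
      using B[OF that(2)] that(1) by (auto simp: \<psi> q' simp flip: p'(5))
    show "\<psi> (opn B n c xs) = opn B' n c (map \<psi> xs)"
      if c: "c \<in> opers C n" and xs: "xs \<in> lists (carrier B)" and n: "length xs = n" for n c xs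
    proof -
      obtain as where as: "as \<in> lists (carrier A)" "xs = map p as"
        using xs unfolding p_surj[symmetric] lists_image by blast
      have "opn A n c as \<in> carrier A" using opn[OF c as(1)] n as(2) by simp
      moreover have map: "map \<psi> xs = map q as" using as \<psi> by auto
      ultimately show ?thesis
        unfolding map
        using n as(2) alg_homD(2)[OF p c as(1)] alg_homD(2)[OF q c as(1)] \<psi>[of "opn A n c as"]
        by simp
    qed
  qed
  ultimately show ?thesis
    using \<psi> by (auto simp: alg_iso_def bij_betw_def)
qed

section \<open>Ideals\<close>

context operad_algebra
begin

lemma alg_idealI:
  assumes "I \<subseteq> carrier A" "\<zero>\<^bsub>A\<^esub> \<in> I"
    and "\<And>x y. \<lbrakk>x \<in> I; y \<in> I\<rbrakk> \<Longrightarrow> x \<oplus>\<^bsub>A\<^esub> y \<in> I"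
    and "\<And>k x. \<lbrakk>k \<in> carrier F; x \<in> I\<rbrakk> \<Longrightarrow> k \<odot>\<^bsub>A\<^esub> x \<in> I"
    and "\<And>n c xs x ys. \<lbrakk>c \<in> opers C n; xs \<in> lists (carrier A); x \<in> I; ys \<in> lists (carrier A);
      length xs + 1 + length ys = n\<rbrakk> \<Longrightarrow> opn A n c (xs @ x # ys) \<in> I"
  shows "alg_ideal F C A I"
  unfolding alg_ideal_def
  using assms alg_vectorspace alg.module.module_axioms
  by (intro conjI subspace.intro submodule.intro) (auto simp: vectorspace_def)

lemma alg_idealD:
  assumes "alg_ideal F C A I"
  shows "I \<subseteq> carrier A" "\<zero>\<^bsub>A\<^esub> \<in> I"
    and "\<lbrakk>x \<in> I; y \<in> I\<rbrakk> \<Longrightarrow> x \<oplus>\<^bsub>A\<^esub> y \<in> I"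
    and "\<lbrakk>k \<in> carrier F; x \<in> I\<rbrakk> \<Longrightarrow> k \<odot>\<^bsub>A\<^esub> x \<in> I"
    and "x \<in> I \<Longrightarrow> \<ominus>\<^bsub>A\<^esub> x \<in> I"
    and "\<lbrakk>x \<in> I; y \<in> I\<rbrakk> \<Longrightarrow> x \<ominus>\<^bsub>A\<^esub> y \<in> I"
    and "\<lbrakk>c \<in> opers C n; xs \<in> lists (carrier A); x \<in> I; ys \<in> lists (carrier A);
      length xs + 1 + length ys = n\<rbrakk> \<Longrightarrow> opn A n c (xs @ x # ys) \<in> I"
proof -
  have sub: "submodule F I A"
    using assms by (simp add: alg_ideal_def subspace_def)
  show cl: "I \<subseteq> carrier A" "\<zero>\<^bsub>A\<^esub> \<in> I" "\<lbrakk>x \<in> I; y \<in> I\<rbrakk> \<Longrightarrow> x \<oplus>\<^bsub>A\<^esub> y \<in> I" for x y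
    using submodule.subset[OF sub] submodule.zero_closed[OF sub] submodule.m_closed[OF sub] by auto
  show sm: "\<lbrakk>k \<in> carrier F; x \<in> I\<rbrakk> \<Longrightarrow> k \<odot>\<^bsub>A\<^esub> x \<in> I" for k x
    using submodule.smult_closed[OF sub] by auto
  show neg: "x \<in> I \<Longrightarrow> \<ominus>\<^bsub>A\<^esub> x \<in> I" for x
    using sm[of "\<ominus>\<^bsub>F\<^esub> \<one>\<^bsub>F\<^esub>" x] cl(1) by (auto simp: alg.smult_minus_1)
  show "\<lbrakk>x \<in> I; y \<in> I\<rbrakk> \<Longrightarrow> x \<ominus>\<^bsub>A\<^esub> y \<in> I"
    using cl(3) neg by (simp add: a_minus_def)
  show "\<lbrakk>c \<in> opers C n; xs \<in> lists (carrier A); x \<in> I; ys \<in> lists (carrier A);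
      length xs + 1 + length ys = n\<rbrakk> \<Longrightarrow> opn A n c (xs @ x # ys) \<in> I"
    using assms unfolding alg_ideal_def by auto
qed

lemma alg_ideal_zero: "alg_ideal F C A {\<zero>\<^bsub>A\<^esub>}"
proof (rule alg_idealI; clarsimp?)
  fix c xs ys
  assume "c \<in> opers C (Suc (length xs + length ys))"
    "\<forall>x\<in>set xs. x \<in> carrier A" "\<forall>x\<in>set ys. x \<in> carrier A"
  then show "opn A (Suc (length xs + length ys)) c (xs @ \<zero>\<^bsub>A\<^esub> # ys) = \<zero>\<^bsub>A\<^esub>"
    using linear_mapD(6)[OF opn_slot[of c "Suc (length xs + length ys)" xs ys]] by auto
qed

lemma alg_ideal_Inter:
  assumes "\<And>i. i \<in> S \<Longrightarrow> alg_ideal F C A (I i)"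
  shows "alg_ideal F C A (carrier A \<inter> (\<Inter>i\<in>S. I i))"
  using assms[THEN alg_idealD(2)] assms[THEN alg_idealD(3)] assms[THEN alg_idealD(4)]
    assms[THEN alg_idealD(7)]
  by (intro alg_idealI) (auto intro!: opn_closed)

lemma alg_ideal_sum:
  assumes I: "alg_ideal F C A I" and J: "alg_ideal F C A J"
  shows "alg_ideal F C A {x \<oplus>\<^bsub>A\<^esub> y | x y. x \<in> I \<and> y \<in> J}" (is "alg_ideal F C A ?S")
proof (rule alg_idealI)
  note I' = alg_idealD[OF I] and J' = alg_idealD[OF J]
  have mem: "u \<oplus>\<^bsub>A\<^esub> v \<in> ?S" if "u \<in> I" "v \<in> J" for u v
    using that by blast
  have car: "u \<in> carrier A" if "u \<in> I \<or> u \<in> J" for u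
    using that I'(1) J'(1) by blast
  show "?S \<subseteq> carrier A" using car by auto
  show "\<zero>\<^bsub>A\<^esub> \<in> ?S" using mem[OF I'(2) J'(2)] by simp
  show "s \<oplus>\<^bsub>A\<^esub> t \<in> ?S" if st: "s \<in> ?S" "t \<in> ?S" for s t
  proof -
    obtain x y x' y' where xy: "x \<in> I" "y \<in> J" "x' \<in> I" "y' \<in> J"
      and s: "s = x \<oplus>\<^bsub>A\<^esub> y" and t: "t = x' \<oplus>\<^bsub>A\<^esub> y'"
      using st by blast
    have "s \<oplus>\<^bsub>A\<^esub> t = (x \<oplus>\<^bsub>A\<^esub> x') \<oplus>\<^bsub>A\<^esub> (y \<oplus>\<^bsub>A\<^esub> y')"
      unfolding s t using xy car by (simp add: alg.M.add.m_ac)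
    then show ?thesis using mem[of "x \<oplus>\<^bsub>A\<^esub> x'" "y \<oplus>\<^bsub>A\<^esub> y'"] xy I'(3) J'(3) by simp
  qed
  show "k \<odot>\<^bsub>A\<^esub> s \<in> ?S" if k: "k \<in> carrier F" and s: "s \<in> ?S" for k s
  proof -
    obtain x y where xy: "x \<in> I" "y \<in> J" and s: "s = x \<oplus>\<^bsub>A\<^esub> y" using s by blast
    then have "k \<odot>\<^bsub>A\<^esub> s = k \<odot>\<^bsub>A\<^esub> x \<oplus>\<^bsub>A\<^esub> k \<odot>\<^bsub>A\<^esub> y"
      using k car by (simp add: alg.smult_r_distr)
    then show ?thesis using mem[OF I'(4)[OF k xy(1)] J'(4)[OF k xy(2)]] by simp
  qed
  show "opn A n c (xs @ s # ys) \<in> ?S"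
    if c: "c \<in> opers C n" "xs \<in> lists (carrier A)" and s: "s \<in> ?S"
      and ys: "ys \<in> lists (carrier A)" "length xs + 1 + length ys = n" for n c xs s ys
  proof -
    obtain x y where xy: "x \<in> I" "y \<in> J" and s: "s = x \<oplus>\<^bsub>A\<^esub> y" using s by blast
    then have "opn A n c (xs @ s # ys) = opn A n c (xs @ x # ys) \<oplus>\<^bsub>A\<^esub> opn A n c (xs @ y # ys)"
      using linear_mapD(4)[OF opn_slot[OF c ys]] car by simp
    then show ?thesis
      using mem[OF I'(7)[OF c xy(1) ys] J'(7)[OF c xy(2) ys]] by simp
  qed
qed

lemma alg_ideal_vimage:
  assumes f: "f \<in> alg_hom F C A B" and B: "operad_algebra F C B" and J: "alg_ideal F C B J"
  shows "alg_ideal F C A {a \<in> carrier A. f a \<in> J}"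
proof -
  interpret B: operad_algebra F C B by (rule B)
  note f' = linear_mapD[OF alg_homD(1)[OF f]]
  show ?thesis
  proof (rule alg_idealI)
    fix n c xs x ys
    assume c: "c \<in> opers C n" and xs: "xs \<in> lists (carrier A)" and x: "x \<in> {a \<in> carrier A. f a \<in> J}"
      and ys: "ys \<in> lists (carrier A)" and n: "length xs + 1 + length ys = n"
    have args: "xs @ x # ys \<in> lists (carrier A)" "length (xs @ x # ys) = n"
      using xs x ys n by auto
    have "f (opn A n c (xs @ x # ys)) = opn B n c (map f xs @ f x # map f ys)"
      using alg_homD(2)[OF f c args] by simp
    also have "\<dots> \<in> J"
      using xs x ys n f'(3) by (intro B.alg_idealD(7)[OF J c]) auto
    finally show "opn A n c (xs @ x # ys) \<in> {a \<in> carrier A. f a \<in> J}"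
      using opn_closed[OF c args] by simp
  qed (auto simp: f' intro: B.alg_idealD[OF J])
qed

lemma alg_ideal_image:
  assumes f: "f \<in> alg_hom F C A B" and surj: "f ` carrier A = carrier B"
    and B: "operad_algebra F C B" and I: "alg_ideal F C A I"
  shows "alg_ideal F C B (f ` I)"
proof -
  interpret B: operad_algebra F C B by (rule B)
  note f' = linear_mapD[OF alg_homD(1)[OF f]] and I' = alg_idealD[OF I]
  have car: "x \<in> carrier A" if "x \<in> I" for x using that I'(1) by blast
  show ?thesis
  proof (rule B.alg_idealI)
    show "f ` I \<subseteq> carrier B" using car f'(3) by blast
    show "\<zero>\<^bsub>B\<^esub> \<in> f ` I" using I'(2) f'(6) by (metis imageI)
    show "x \<oplus>\<^bsub>B\<^esub> y \<in> f ` I" if "x \<in> f ` I" "y \<in> f ` I" for x y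
      using that I'(3) by (auto simp: car simp flip: f'(4))
    show "k \<odot>\<^bsub>B\<^esub> x \<in> f ` I" if "k \<in> carrier F" "x \<in> f ` I" for k x
      using that I'(4) by (auto simp: car simp flip: f'(5))
    fix n c xs x ys
    assume c: "c \<in> opers C n" and xs: "xs \<in> lists (carrier B)" and x: "x \<in> f ` I"
      and ys: "ys \<in> lists (carrier B)" and n: "length xs + 1 + length ys = n"
    obtain as where as: "as \<in> lists (carrier A)" "xs = map f as"
      using xs unfolding surj[symmetric] lists_image by blast
    obtain bs where bs: "bs \<in> lists (carrier A)" "ys = map f bs"
      using ys unfolding surj[symmetric] lists_image by blast
    obtain a where a: "a \<in> I" "x = f a" using x by blast
    have "f (opn A n c (as @ a # bs)) = opn B n c (xs @ x # ys)"
      using as bs a car n by (subst alg_homD(2)[OF f c]) auto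
    moreover have "opn A n c (as @ a # bs) \<in> I"
      using as bs n by (intro I'(7)[OF c _ a(1)]) auto
    ultimately show "opn B n c (xs @ x # ys) \<in> f ` I" by (metis imageI)
  qed
qed

lemma alg_ideal_ker:
  assumes "f \<in> alg_hom F C A B" and "operad_algebra F C B"
  shows "alg_ideal F C A {a \<in> carrier A. f a = \<zero>\<^bsub>B\<^esub>}"
  using alg_ideal_vimage[OF assms operad_algebra.alg_ideal_zero[OF assms(2)]] by simp

text \<open>Among all pairs of a proper ideal and a linearly independent subset of it, take one whose subset is
  largest. Its ideal is maximal, since a vector of a larger ideal could be added to the subset.\<close>

lemma maximal_ideal_exists:
  assumes fin: "vectorspace.fin_dim F A" and I: "alg_ideal F C A I" "I \<noteq> carrier A"
  shows "\<exists>M. alg_ideal F C A M \<and> M \<noteq> carrier A \<and>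
    (\<forall>J. alg_ideal F C A J \<and> M \<subseteq> J \<longrightarrow> J = M \<or> J = carrier A)"
proof -
  define P where "P = (\<lambda>(J, S). alg_ideal F C A J \<and> J \<noteq> carrier A \<and> S \<subseteq> J \<and> alg.lin_indpt S)"
  have bound: "finite (snd q) \<and> card (snd q) < Suc alg.dim" if q: "P q" for q
  proof -
    have "snd q \<subseteq> carrier A" "alg.lin_indpt (snd q)"
      using q alg_idealD(1) by (fastforce simp: P_def)+
    then show ?thesis using alg.li_le_dim[OF fin] by (simp add: less_Suc_eq_le)
  qed
  have "P (I, {})" using I by (auto simp: P_def alg.lin_dep_def)
  then obtain q where q: "P q" and max: "\<And>r. P r \<Longrightarrow> card (snd r) \<le> card (snd q)"
    using ex_has_greatest_nat[of P "(I, {})" "\<lambda>q. card (snd q)" "Suc alg.dim"] bound by blast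
  obtain M S where MS: "q = (M, S)" by fastforce
  have M: "alg_ideal F C A M" "M \<noteq> carrier A" and S: "S \<subseteq> M" "alg.lin_indpt S"
    using q by (auto simp: P_def MS)
  have "J = M \<or> J = carrier A" if J: "alg_ideal F C A J" "M \<subseteq> J" for J
  proof (rule ccontr)
    assume "\<not> (J = M \<or> J = carrier A)"
    then obtain v where v: "v \<in> J" "v \<notin> M" and proper: "J \<noteq> carrier A"
      using J(2) by blast
    have "alg.span S \<subseteq> M"
      using S(1) M(1) by (intro alg.span_is_subset) (auto simp: alg_ideal_def subspace_def)
    then have "alg.lin_indpt (S \<union> {v})"
      using alg.lin_dep_iff_in_span[of S v] S v alg_idealD(1)[OF M(1)] alg_idealD(1)[OF J(1)]
      by blast
    then have "P (J, insert v S)"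
      using J proper S v by (auto simp: P_def)
    from max[OF this] show False
      using bound[OF q] S(1) v(2) by (auto simp: MS card_insert_if split: if_splits)
  qed
  then show ?thesis using M by blast
qed

text \<open>Changing the arguments one at a time changes the value by elements of the ideal.\<close>

lemma opn_cong_mod_ideal:
  assumes M: "alg_ideal F C A M" and c: "c \<in> opers C n" and n: "length xs = n"
    and xy: "list_all2 (\<lambda>x y. x \<in> carrier A \<and> y \<in> carrier A \<and> x \<ominus>\<^bsub>A\<^esub> y \<in> M) xs ys"
  shows "opn A n c xs \<ominus>\<^bsub>A\<^esub> opn A n c ys \<in> M"
proof -
  note M' = alg_idealD[OF M]
  \<comment> \<open>The prefix \<open>us\<close> consists of the arguments that have already been exchanged.\<close>
  have "opn A n c (us @ xs) \<ominus>\<^bsub>A\<^esub> opn A n c (us @ ys) \<in> M"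
    if "us \<in> lists (carrier A)" "length us + length xs = n" for us
    using xy that
  proof (induction arbitrary: us rule: list_all2_induct)
    case Nil
    then show ?case using opn_closed[OF c] M'(2) by (simp add: alg.M.r_neg a_minus_def)
  next
    case (Cons x xs y ys)
    have len: "length ys = length xs" using Cons.hyps(2) by (simp add: list_all2_lengthD)
    have car: "xs \<in> lists (carrier A)" "ys \<in> lists (carrier A)"
      using Cons.hyps(2) by (auto simp: list_all2_conv_all_nth in_set_conv_nth)
    let ?u = "opn A n c (us @ x # xs)" and ?v = "opn A n c (us @ y # xs)"
      and ?w = "opn A n c (us @ y # ys)"
    have "?u \<ominus>\<^bsub>A\<^esub> ?v = opn A n c (us @ (x \<ominus>\<^bsub>A\<^esub> y) # xs)"
      using linear_mapD(7)[OF opn_slot[OF c Cons.prems(1) car(1)]] Cons.hyps(1) Cons.prems(2)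
      by simp
    also have "\<dots> \<in> M"
      using Cons.hyps(1) Cons.prems car by (intro M'(7)[OF c]) auto
    finally have uv: "?u \<ominus>\<^bsub>A\<^esub> ?v \<in> M" .
    have vw: "?v \<ominus>\<^bsub>A\<^esub> ?w \<in> M"
      using Cons.IH[of "us @ [y]"] Cons.hyps(1) Cons.prems by simp
    have cl: "?u \<in> carrier A" "?v \<in> carrier A" "?w \<in> carrier A"
      using Cons.prems Cons.hyps(1) car len by (intro opn_closed[OF c]; simp)+
    have "?u \<ominus>\<^bsub>A\<^esub> ?w = (?u \<ominus>\<^bsub>A\<^esub> ?v) \<oplus>\<^bsub>A\<^esub> (?v \<ominus>\<^bsub>A\<^esub> ?w)"
      using cl by (simp add: a_minus_def alg.M.add.m_assoc alg.M.r_neg1)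
    then show ?case using M'(3)[OF uv vw] by simp
  qed
  from this[of "[]"] show ?thesis using n by simp
qed

text \<open>The quotient \<open>A / M\<close> is built on a set of representatives of the cosets rather than on the cosets
  themselves. In this way it has the same element type as \<open>A\<close>, as needed for the algebra \<open>B\<close> that
  presents \<open>A\<close>.\<close>

lemma alg_quotient_exists:
  assumes M: "alg_ideal F C A M"
  shows "\<exists>(B :: ('k, 'c, 'a) operad_alg) p. operad_algebra F C B \<and> p \<in> alg_hom F C A B \<and>
    p ` carrier A = carrier B \<and> (\<forall>a\<in>carrier A. p a = \<zero>\<^bsub>B\<^esub> \<longleftrightarrow> a \<in> M)"
proof -
  note M' = alg_idealD[OF M]
  have Mcar: "x \<in> carrier A" if "x \<in> M" for x using that M'(1) by blast
  have minus_swap: "y \<ominus>\<^bsub>A\<^esub> x = \<ominus>\<^bsub>A\<^esub> (x \<ominus>\<^bsub>A\<^esub> y)" if "x \<in> carrier A" "y \<in> carrier A" for x y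
    using that by (simp add: a_minus_def alg.M.minus_add alg.M.add.m_comm)
  have minus_trans: "x \<ominus>\<^bsub>A\<^esub> z = (x \<ominus>\<^bsub>A\<^esub> y) \<oplus>\<^bsub>A\<^esub> (y \<ominus>\<^bsub>A\<^esub> z)"
    if "x \<in> carrier A" "y \<in> carrier A" "z \<in> carrier A" for x y z
    using that by (simp add: a_minus_def alg.M.add.m_assoc alg.M.r_neg1)
  \<comment> \<open>The chosen representative depends on the coset only, because the choice is made from a predicate
    that depends on the coset only.\<close>
  define p where "p a = (SOME b. b \<in> carrier A \<and> a \<ominus>\<^bsub>A\<^esub> b \<in> M)" for a
  have p: "p a \<in> carrier A" "a \<ominus>\<^bsub>A\<^esub> p a \<in> M" if "a \<in> carrier A" for a
  proof -
    have "a \<in> carrier A \<and> a \<ominus>\<^bsub>A\<^esub> a \<in> M"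
      using that M'(2) by (simp add: a_minus_def alg.M.r_neg)
    then have "p a \<in> carrier A \<and> a \<ominus>\<^bsub>A\<^esub> p a \<in> M"
      unfolding p_def by (rule someI)
    then show "p a \<in> carrier A" "a \<ominus>\<^bsub>A\<^esub> p a \<in> M" by auto
  qed
  have p_eq: "p a = p b" if ab: "a \<in> carrier A" "b \<in> carrier A" "a \<ominus>\<^bsub>A\<^esub> b \<in> M" for a b
  proof -
    have "a \<ominus>\<^bsub>A\<^esub> d \<in> M \<longleftrightarrow> b \<ominus>\<^bsub>A\<^esub> d \<in> M" if d: "d \<in> carrier A" for d
      using minus_trans[OF ab(1,2) d] minus_trans[OF ab(2,1) d] minus_swap[OF ab(1,2)]
        M'(3)[OF ab(3), of "b \<ominus>\<^bsub>A\<^esub> d"] M'(3)[OF M'(5)[OF ab(3)], of "a \<ominus>\<^bsub>A\<^esub> d"] by metis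
    then show ?thesis unfolding p_def by (metis (no_types, lifting))
  qed
  define B :: "('k, 'c, 'a) operad_alg" where
    "B = \<lparr>carrier = p ` carrier A, mult = undefined, one = undefined, zero = p \<zero>\<^bsub>A\<^esub>,
      add = (\<lambda>x y. p (x \<oplus>\<^bsub>A\<^esub> y)), smult = (\<lambda>k x. p (k \<odot>\<^bsub>A\<^esub> x)),
      opn = (\<lambda>n c xs. p (opn A n c xs))\<rparr>"
  have surj: "p ` carrier A = carrier B" and zero: "p \<zero>\<^bsub>A\<^esub> = \<zero>\<^bsub>B\<^esub>"
    by (simp_all add: B_def)
  have add: "p (x \<oplus>\<^bsub>A\<^esub> y) = p x \<oplus>\<^bsub>B\<^esub> p y" if xy: "x \<in> carrier A" "y \<in> carrier A" for x y
  proof -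
    have "(x \<oplus>\<^bsub>A\<^esub> y) \<ominus>\<^bsub>A\<^esub> (p x \<oplus>\<^bsub>A\<^esub> p y) = (x \<ominus>\<^bsub>A\<^esub> p x) \<oplus>\<^bsub>A\<^esub> (y \<ominus>\<^bsub>A\<^esub> p y)"
      using xy p(1) by (simp add: a_minus_def alg.M.minus_add alg.M.add.m_ac)
    also have "\<dots> \<in> M" using xy by (intro M'(3) p)
    finally show ?thesis using xy p(1) by (simp add: B_def p_eq)
  qed
  have smult: "p (k \<odot>\<^bsub>A\<^esub> x) = k \<odot>\<^bsub>B\<^esub> p x" if kx: "k \<in> carrier F" "x \<in> carrier A" for k x
  proof -
    have "linear_map F A A (\<lambda>x. k \<odot>\<^bsub>A\<^esub> x)"
      using kx(1) alg.R.m_comm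
      by (intro linear_mapI alg_vectorspace)
        (auto simp: alg.smult_r_distr simp flip: alg.smult_assoc1)
    then have "k \<odot>\<^bsub>A\<^esub> x \<ominus>\<^bsub>A\<^esub> k \<odot>\<^bsub>A\<^esub> p x = k \<odot>\<^bsub>A\<^esub> (x \<ominus>\<^bsub>A\<^esub> p x)"
      using linear_mapD(7) kx(2) p(1)[OF kx(2)] by fastforce
    also have "\<dots> \<in> M" using kx by (intro M'(4) p)
    finally show ?thesis using kx p(1) by (simp add: B_def p_eq)
  qed
  have opn: "p (opn A n c xs) = opn B n c (map p xs)"
    if c: "c \<in> opers C n" and xs: "xs \<in> lists (carrier A)" and n: "length xs = n" for n c xs
  proof -
    have "list_all2 (\<lambda>x y. x \<in> carrier A \<and> y \<in> carrier A \<and> x \<ominus>\<^bsub>A\<^esub> y \<in> M) xs (map p xs)"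
      using xs p by (auto simp: list_all2_conv_all_nth)
    from opn_cong_mod_ideal[OF M c n this] have "p (opn A n c xs) = p (opn A n c (map p xs))"
      using xs n p(1) by (intro p_eq opn_closed[OF c]) auto
    then show ?thesis by (simp add: B_def)
  qed
  have "p a = \<zero>\<^bsub>B\<^esub> \<longleftrightarrow> a \<in> M" if a: "a \<in> carrier A" for a
  proof
    assume "p a = \<zero>\<^bsub>B\<^esub>"
    then have eq: "p a = p \<zero>\<^bsub>A\<^esub>" by (simp add: B_def)
    have pz: "p \<zero>\<^bsub>A\<^esub> \<in> M"
      using M'(5)[OF p(2)[of "\<zero>\<^bsub>A\<^esub>"]] p(1)[of "\<zero>\<^bsub>A\<^esub>"] by (simp add: a_minus_def)
    have "a = (a \<ominus>\<^bsub>A\<^esub> p a) \<oplus>\<^bsub>A\<^esub> p a"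
      using a p(1) by (simp add: a_minus_def alg.M.add.m_assoc alg.M.l_neg)
    then show "a \<in> M" using M'(3)[OF p(2)[OF a] pz] eq by simp
  next
    assume "a \<in> M"
    then have "p a = p \<zero>\<^bsub>A\<^esub>" using a M'(6)[OF _ M'(2)] by (intro p_eq) simp_all
    then show "p a = \<zero>\<^bsub>B\<^esub>" by (simp add: B_def)
  qed
  then show ?thesis
    using operad_algebra_surj_image[of p B, OF surj zero add smult opn] surj by blast
qed

end

section \<open>The operators \<open>E\<^sub>A\<close>\<close>

lemma End_vs_memI:
  assumes "vectorspace F V"
    and "\<And>x. x \<in> carrier V \<Longrightarrow> f x \<in> carrier V"
    and "\<And>x y. \<lbrakk>x \<in> carrier V; y \<in> carrier V\<rbrakk> \<Longrightarrow> f (x \<oplus>\<^bsub>V\<^esub> y) = f x \<oplus>\<^bsub>V\<^esub> f y"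
    and "\<And>k x. \<lbrakk>k \<in> carrier F; x \<in> carrier V\<rbrakk> \<Longrightarrow> f (k \<odot>\<^bsub>V\<^esub> x) = k \<odot>\<^bsub>V\<^esub> f x"
  shows "(\<lambda>x\<in>carrier V. f x) \<in> carrier (End_vs F V)"
proof -
  interpret vectorspace F V by (rule assms(1))
  have "linear_map F V V (\<lambda>x\<in>carrier V. f x)"
    by (rule linear_mapI[OF assms(1,1)]) (simp_all add: assms(2-4))
  then show ?thesis by (simp add: End_vs_def)
qed

lemma End_vs_module:
  assumes V: "vectorspace F V"
  shows "module F (End_vs F V)"
proof -
  interpret vectorspace F V by (rule V)
  let ?E = "End_vs F V"
  have memD: "f \<in> extensional (carrier V)"
    "x \<in> carrier V \<Longrightarrow> f x \<in> carrier V"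
    "\<lbrakk>x \<in> carrier V; y \<in> carrier V\<rbrakk> \<Longrightarrow> f (x \<oplus>\<^bsub>V\<^esub> y) = f x \<oplus>\<^bsub>V\<^esub> f y"
    "\<lbrakk>k \<in> carrier F; x \<in> carrier V\<rbrakk> \<Longrightarrow> f (k \<odot>\<^bsub>V\<^esub> x) = k \<odot>\<^bsub>V\<^esub> f x"
    if "f \<in> carrier ?E" for f x y k
    using that linear_mapD(3-5)[of F V V f] by (auto simp: End_vs_def)
  have eqI: "f = g" if "f \<in> extensional (carrier V)" "g \<in> extensional (carrier V)"
    "\<And>x. x \<in> carrier V \<Longrightarrow> f x = g x" for f g :: "'c \<Rightarrow> 'c"
    using that by (rule extensionalityI)
  have ops: "f \<oplus>\<^bsub>?E\<^esub> g = (\<lambda>x\<in>carrier V. f x \<oplus>\<^bsub>V\<^esub> g x)" "\<zero>\<^bsub>?E\<^esub> = (\<lambda>x\<in>carrier V. \<zero>\<^bsub>V\<^esub>)"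
    "k \<odot>\<^bsub>?E\<^esub> f = (\<lambda>x\<in>carrier V. k \<odot>\<^bsub>V\<^esub> f x)" for f g k
    by (simp_all add: End_vs_def)
  have smult_comm: "k \<odot>\<^bsub>V\<^esub> (l \<odot>\<^bsub>V\<^esub> x) = l \<odot>\<^bsub>V\<^esub> (k \<odot>\<^bsub>V\<^esub> x)"
    if "k \<in> carrier F" "l \<in> carrier F" "x \<in> carrier V" for k l x
    using that R.m_comm by (simp flip: smult_assoc1)
  have add_cl: "f \<oplus>\<^bsub>?E\<^esub> g \<in> carrier ?E" if "f \<in> carrier ?E" "g \<in> carrier ?E" for f g
    unfolding ops using that[THEN memD(2)] that[THEN memD(3)] that[THEN memD(4)]
    by (intro End_vs_memI V) (auto simp: M.add.m_ac smult_r_distr)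
  have smult_cl: "k \<odot>\<^bsub>?E\<^esub> f \<in> carrier ?E" if "k \<in> carrier F" "f \<in> carrier ?E" for k f
    unfolding ops using that memD(2-4)[OF that(2)]
    by (intro End_vs_memI V) (auto simp: smult_r_distr smult_comm)
  have zero_cl: "\<zero>\<^bsub>?E\<^esub> \<in> carrier ?E"
    unfolding ops by (intro End_vs_memI V) auto
  have "abelian_group ?E"
  proof (rule abelian_groupI)
    fix f g h assume f: "f \<in> carrier ?E" and g: "g \<in> carrier ?E"
    show "f \<oplus>\<^bsub>?E\<^esub> g \<in> carrier ?E" by (rule add_cl[OF f g])
    show "f \<oplus>\<^bsub>?E\<^esub> g = g \<oplus>\<^bsub>?E\<^esub> f"
      unfolding ops using memD(2)[OF f] memD(2)[OF g] by (intro eqI) (auto simp: M.add.m_comm)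
    show "f \<oplus>\<^bsub>?E\<^esub> g \<oplus>\<^bsub>?E\<^esub> h = f \<oplus>\<^bsub>?E\<^esub> (g \<oplus>\<^bsub>?E\<^esub> h)" if h: "h \<in> carrier ?E"
      unfolding ops using memD(2)[OF f] memD(2)[OF g] memD(2)[OF h]
      by (intro eqI) (auto simp: M.add.m_assoc)
    show "\<zero>\<^bsub>?E\<^esub> \<oplus>\<^bsub>?E\<^esub> f = f"
      unfolding ops using memD(1,2)[OF f] by (intro eqI) auto
    show "\<exists>g\<in>carrier ?E. g \<oplus>\<^bsub>?E\<^esub> f = \<zero>\<^bsub>?E\<^esub>"
    proof (rule bexI)
      show "(\<ominus>\<^bsub>F\<^esub> \<one>\<^bsub>F\<^esub>) \<odot>\<^bsub>?E\<^esub> f \<in> carrier ?E" by (rule smult_cl[OF _ f]) simp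
      show "(\<ominus>\<^bsub>F\<^esub> \<one>\<^bsub>F\<^esub>) \<odot>\<^bsub>?E\<^esub> f \<oplus>\<^bsub>?E\<^esub> f = \<zero>\<^bsub>?E\<^esub>"
        unfolding ops using memD(2)[OF f] by (intro eqI) (auto simp: smult_minus_1 M.l_neg)
    qed
  qed (rule zero_cl)
  moreover have "cring F" by (rule R.is_cring)
  ultimately show ?thesis
  proof (intro moduleI)
    fix k l f g assume k: "k \<in> carrier F" and f: "f \<in> carrier ?E"
    show "k \<odot>\<^bsub>?E\<^esub> f \<in> carrier ?E" by (rule smult_cl[OF k f])
    show "(k \<oplus>\<^bsub>F\<^esub> l) \<odot>\<^bsub>?E\<^esub> f = k \<odot>\<^bsub>?E\<^esub> f \<oplus>\<^bsub>?E\<^esub> l \<odot>\<^bsub>?E\<^esub> f" if l: "l \<in> carrier F"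
      unfolding ops using memD(2)[OF f] k l by (intro eqI) (auto simp: smult_l_distr)
    show "(k \<otimes>\<^bsub>F\<^esub> l) \<odot>\<^bsub>?E\<^esub> f = k \<odot>\<^bsub>?E\<^esub> (l \<odot>\<^bsub>?E\<^esub> f)" if l: "l \<in> carrier F"
      unfolding ops using memD(2)[OF f] k l by (intro eqI) (auto simp: smult_assoc1)
    show "k \<odot>\<^bsub>?E\<^esub> (f \<oplus>\<^bsub>?E\<^esub> g) = k \<odot>\<^bsub>?E\<^esub> f \<oplus>\<^bsub>?E\<^esub> k \<odot>\<^bsub>?E\<^esub> g" if g: "g \<in> carrier ?E"
      unfolding ops using memD(2)[OF f] memD(2)[OF g] k by (intro eqI) (auto simp: smult_r_distr)
  next
    fix f assume f: "f \<in> carrier ?E"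
    show "\<one>\<^bsub>F\<^esub> \<odot>\<^bsub>?E\<^esub> f = f"
      unfolding ops using memD(1,2)[OF f] by (intro eqI) auto
  qed
qed

context operad_algebra
begin

text \<open>A span is zero iff its generators are, and the generators of \<open>E\<^sub>A\<close> are the values of the
  operations of arity at least two as functions of one argument. In this elementary form the condition
  \<open>E\<^sub>A \<noteq> 0\<close> can be moved along epimorphisms.\<close>

lemma E_space_nonzero_iff:
  "E_space F C A \<noteq> {\<zero>\<^bsub>End_vs F A\<^esub>} \<longleftrightarrow>
    (\<exists>n\<ge>2. \<exists>c\<in>opers C n. \<exists>xs\<in>lists (carrier A). length xs = n \<and> opn A n c xs \<noteq> \<zero>\<^bsub>A\<^esub>)"
proof -
  define S where "S = {(\<lambda>x\<in>carrier A. opn A n c (xs @ x # ys)) | n c xs ys.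
        n \<ge> 2 \<and> c \<in> opers C n \<and> xs \<in> lists (carrier A) \<and> ys \<in> lists (carrier A) \<and>
        length xs + 1 + length ys = n}"
  interpret E: module F "End_vs F A" by (rule End_vs_module[OF alg_vectorspace])
  have span: "E_space F C A = E.span S"
    by (simp add: E_space_def S_def)
  have S: "S \<subseteq> carrier (End_vs F A)"
  proof
    fix s assume "s \<in> S"
    then obtain n c xs ys where s: "s = (\<lambda>x\<in>carrier A. opn A n c (xs @ x # ys))"
      and c: "c \<in> opers C n" and xy: "xs \<in> lists (carrier A)" "ys \<in> lists (carrier A)"
        "length xs + 1 + length ys = n"
      unfolding S_def by blast
    note slot = linear_mapD(3-5)[OF opn_slot[OF c xy]]
    show "s \<in> carrier (End_vs F A)"
      unfolding s by (rule End_vs_memI[OF alg_vectorspace slot])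
  qed
  have zero: "\<zero>\<^bsub>End_vs F A\<^esub> = (\<lambda>x\<in>carrier A. \<zero>\<^bsub>A\<^esub>)"
    by (simp add: End_vs_def)
  have "E.span S \<noteq> {\<zero>\<^bsub>End_vs F A\<^esub>} \<longleftrightarrow> (\<exists>s\<in>S. s \<noteq> \<zero>\<^bsub>End_vs F A\<^esub>)"
  proof
    have "submodule F {\<zero>\<^bsub>End_vs F A\<^esub>} (End_vs F A)"
      using E.module_axioms by (intro submodule.intro) (auto simp: E.rmult_0)
    then have "E.span S \<subseteq> {\<zero>\<^bsub>End_vs F A\<^esub>}" if "S \<subseteq> {\<zero>\<^bsub>End_vs F A\<^esub>}"
      using E.span_is_subset[OF that] by blast
    moreover have "\<zero>\<^bsub>End_vs F A\<^esub> \<in> E.span S"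
      using E.span_is_submodule[OF S] by (rule submodule.zero_closed)
    moreover assume "E.span S \<noteq> {\<zero>\<^bsub>End_vs F A\<^esub>}"
    ultimately show "\<exists>s\<in>S. s \<noteq> \<zero>\<^bsub>End_vs F A\<^esub>" by blast
  next
    assume "\<exists>s\<in>S. s \<noteq> \<zero>\<^bsub>End_vs F A\<^esub>"
    then show "E.span S \<noteq> {\<zero>\<^bsub>End_vs F A\<^esub>}"
      using E.in_own_span[OF S] by blast
  qed
  also have "\<dots> \<longleftrightarrow>
    (\<exists>n\<ge>2. \<exists>c\<in>opers C n. \<exists>xs\<in>lists (carrier A). length xs = n \<and> opn A n c xs \<noteq> \<zero>\<^bsub>A\<^esub>)"
  proof
    assume "\<exists>s\<in>S. s \<noteq> \<zero>\<^bsub>End_vs F A\<^esub>"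
    then obtain n c xs ys where nc: "n \<ge> 2" "c \<in> opers C n"
      and xy: "xs \<in> lists (carrier A)" "ys \<in> lists (carrier A)" "length xs + 1 + length ys = n"
      and "(\<lambda>x\<in>carrier A. opn A n c (xs @ x # ys)) \<noteq> (\<lambda>x\<in>carrier A. \<zero>\<^bsub>A\<^esub>)"
      unfolding S_def zero by blast
    then obtain x where "x \<in> carrier A" "opn A n c (xs @ x # ys) \<noteq> \<zero>\<^bsub>A\<^esub>"
      by (meson restrict_ext)
    then show "\<exists>n\<ge>2. \<exists>c\<in>opers C n. \<exists>xs\<in>lists (carrier A). length xs = n \<and> opn A n c xs \<noteq> \<zero>\<^bsub>A\<^esub>"
      using nc xy by (intro exI[of _ n] conjI bexI[of _ c] bexI[of _ "xs @ x # ys"]) auto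
  next
    assume "\<exists>n\<ge>2. \<exists>c\<in>opers C n. \<exists>xs\<in>lists (carrier A). length xs = n \<and> opn A n c xs \<noteq> \<zero>\<^bsub>A\<^esub>"
    then obtain n c xs where nc: "n \<ge> 2" "c \<in> opers C n" and xs: "xs \<in> lists (carrier A)" "length xs = n"
      and nz: "opn A n c xs \<noteq> \<zero>\<^bsub>A\<^esub>" by blast
    \<comment> \<open>Any slot detects a nonzero value; the first one is used.\<close>
    obtain x ys where xs_eq: "xs = x # ys" using nc(1) xs(2) by (cases xs) auto
    let ?s = "\<lambda>z\<in>carrier A. opn A n c ([] @ z # ys)"
    have "?s \<in> S"
      unfolding S_def using nc xs xs_eq by (intro CollectI exI conjI) (rule refl, auto)
    moreover have "?s x \<noteq> (\<lambda>x\<in>carrier A. \<zero>\<^bsub>A\<^esub>) x" using nz xs xs_eq by simp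
    then have "?s \<noteq> \<zero>\<^bsub>End_vs F A\<^esub>" unfolding zero by metis
    ultimately show "\<exists>s\<in>S. s \<noteq> \<zero>\<^bsub>End_vs F A\<^esub>" by blast
  qed
  finally show ?thesis unfolding span .
qed

end

section \<open>Ideals with simple quotient\<close>

text \<open>These are the ideals \<open>M\<close> of a finite dimensional algebra \<open>A\<close> for which \<open>A / M\<close> is simple: maximality
  says that \<open>A / M\<close> has only the trivial ideals, and a value outside \<open>M\<close> of an operation of arity
  at least two says that \<open>E\<close> of the quotient is nonzero. Such a value also makes \<open>M\<close> proper.\<close>

definition cosimple_ideal ::
  "('k, 'm) ring_scheme \<Rightarrow> ('k, 'c) operad \<Rightarrow> ('k, 'c, 'a) operad_alg \<Rightarrow> 'a set \<Rightarrow> bool" where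
  "cosimple_ideal F C A M \<longleftrightarrow> alg_ideal F C A M \<and>
     (\<forall>J. alg_ideal F C A J \<and> M \<subseteq> J \<longrightarrow> J = M \<or> J = carrier A) \<and>
     (\<exists>n\<ge>2. \<exists>c\<in>opers C n. \<exists>xs\<in>lists (carrier A). length xs = n \<and> opn A n c xs \<notin> M)"

context operad_algebra
begin

lemma cosimple_idealD:
  assumes "cosimple_ideal F C A M"
  shows "alg_ideal F C A M"
    and "\<lbrakk>alg_ideal F C A J; M \<subseteq> J\<rbrakk> \<Longrightarrow> J = M \<or> J = carrier A"
    and "M \<noteq> carrier A"
  using assms opn_closed by (auto simp: cosimple_ideal_def)

text \<open>Ideals above the kernel correspond to ideals of \<open>B\<close>, and a nonzero value of an operation in \<open>B\<close>
  lifts to a value in \<open>A\<close> outside the kernel.\<close>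

lemma cosimple_ideal_ker:
  assumes p: "p \<in> alg_hom F C A B" and surj: "p ` carrier A = carrier B"
    and B: "simple_algebra F C B"
  shows "cosimple_ideal F C A {a \<in> carrier A. p a = \<zero>\<^bsub>B\<^esub>}" (is "cosimple_ideal F C A ?K")
proof -
  interpret B: operad_algebra F C B using B by (simp add: simple_algebra_def)
  note p' = linear_mapD[OF alg_homD(1)[OF p]]
  have max: "J = ?K \<or> J = carrier A" if J: "alg_ideal F C A J" and sub: "?K \<subseteq> J" for J
  proof -
    note J' = alg_idealD[OF J]
    have J_eq: "J = {a \<in> carrier A. p a \<in> p ` J}"
    proof safe
      fix a j assume a: "a \<in> carrier A" and j: "j \<in> J" and eq: "p a = p j"
      have jA: "j \<in> carrier A" using j J'(1) by blast
      have "a \<ominus>\<^bsub>A\<^esub> j \<in> ?K"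
        using a jA eq p'(3)[OF jA] by (simp add: p'(7) B.alg.minus_eq_zero_iff)
      then have "(a \<ominus>\<^bsub>A\<^esub> j) \<oplus>\<^bsub>A\<^esub> j \<in> J" using sub j J'(3) by blast
      then show "a \<in> J" using a jA by (simp add: a_minus_def alg.M.add.m_assoc alg.M.l_neg)
    qed (use J'(1) in auto)
    have "p ` J = {\<zero>\<^bsub>B\<^esub>} \<or> p ` J = carrier B"
      using alg_ideal_image[OF p surj B.operad_algebra_axioms J] B
      by (auto simp: simple_algebra_def)
    then show ?thesis using J_eq p'(3) by auto
  qed
  obtain n c xs where n: "n \<ge> 2" and c: "c \<in> opers C n" and xs: "xs \<in> lists (carrier B)" "length xs = n"
    and nz: "opn B n c xs \<noteq> \<zero>\<^bsub>B\<^esub>"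
    using B B.E_space_nonzero_iff by (auto simp: simple_algebra_def)
  obtain as where as: "as \<in> lists (carrier A)" "xs = map p as"
    using xs(1) unfolding surj[symmetric] lists_image by blast
  then have "opn A n c as \<notin> ?K"
    using alg_homD(2)[OF p c as(1)] xs(2) nz by simp
  then show ?thesis
    unfolding cosimple_ideal_def
    using alg_ideal_ker[OF p B.operad_algebra_axioms] max n c as xs(2) by auto
qed

lemma simple_quotient:
  assumes M: "cosimple_ideal F C A M" and fin: "vectorspace.fin_dim F A"
    and p: "p \<in> alg_hom F C A B" and surj: "p ` carrier A = carrier B" and B: "operad_algebra F C B"
    and ker: "\<And>a. a \<in> carrier A \<Longrightarrow> p a = \<zero>\<^bsub>B\<^esub> \<longleftrightarrow> a \<in> M"
  shows "simple_algebra F C B"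
proof -
  interpret B: operad_algebra F C B by (rule B)
  interpret p: linear_map F A B p by (rule alg_homD(1)[OF p])
  have pM: "p a = \<zero>\<^bsub>B\<^esub>" if "a \<in> M" for a
    using that ker alg_idealD(1)[OF cosimple_idealD(1)[OF M]] by blast
  have "vectorspace.fin_dim F B"
    by (rule p.surj_fin_dim[OF fin surj])
  moreover have "I = {\<zero>\<^bsub>B\<^esub>} \<or> I = carrier B" if I: "alg_ideal F C B I" for I
  proof -
    let ?J = "{a \<in> carrier A. p a \<in> I}"
    have I_eq: "I = p ` ?J"
      using B.alg_idealD(1)[OF I] surj by auto
    have "M \<subseteq> ?J"
      using alg_idealD(1)[OF cosimple_idealD(1)[OF M]] B.alg_idealD(2)[OF I] pM by auto
    from cosimple_idealD(2)[OF M alg_ideal_vimage[OF p B I] this] show ?thesis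
    proof
      assume J: "?J = M"
      have "p ` M \<subseteq> {\<zero>\<^bsub>B\<^esub>}"
        using pM by blast
      then show ?thesis using I_eq J B.alg_idealD(2)[OF I] by auto
    next
      assume "?J = carrier A"
      then show ?thesis using I_eq surj by simp
    qed
  qed
  moreover have "E_space F C B \<noteq> {\<zero>\<^bsub>End_vs F B\<^esub>}"
  proof -
    obtain n c xs where n: "n \<ge> 2" and c: "c \<in> opers C n" and xs: "xs \<in> lists (carrier A)" "length xs = n"
      and nM: "opn A n c xs \<notin> M"
      using M by (auto simp: cosimple_ideal_def)
    have "opn B n c (map p xs) \<noteq> \<zero>\<^bsub>B\<^esub>"
      using ker[OF opn_closed[OF c xs]] nM alg_homD(2)[OF p c xs] by simp
    moreover have "map p xs \<in> lists (carrier B)" using xs(1) surj by auto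
    ultimately show ?thesis
      unfolding B.E_space_nonzero_iff using n c xs(2) by (metis length_map)
  qed
  ultimately show ?thesis using B by (simp add: simple_algebra_def)
qed

lemma cosimple_ideal_complement:
  assumes M: "cosimple_ideal F C A M" and I: "alg_ideal F C A I" "\<not> I \<subseteq> M" and a: "a \<in> carrier A"
  shows "\<exists>i\<in>I. \<exists>m\<in>M. a = i \<oplus>\<^bsub>A\<^esub> m"
proof -
  let ?S = "{x \<oplus>\<^bsub>A\<^esub> y | x y. x \<in> I \<and> y \<in> M}"
  note I' = alg_idealD[OF I(1)] and M' = alg_idealD[OF cosimple_idealD(1)[OF M]]
  have MS: "M \<subseteq> ?S"
  proof
    fix m assume m: "m \<in> M"
    then have "m = \<zero>\<^bsub>A\<^esub> \<oplus>\<^bsub>A\<^esub> m" using M'(1) by auto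
    then show "m \<in> ?S" using m I'(2) by blast
  qed
  have IS: "I \<subseteq> ?S"
  proof
    fix i assume i: "i \<in> I"
    then have "i = i \<oplus>\<^bsub>A\<^esub> \<zero>\<^bsub>A\<^esub>" using I'(1) by auto
    then show "i \<in> ?S" using i M'(2) by blast
  qed
  from cosimple_idealD(2)[OF M alg_ideal_sum[OF I(1) cosimple_idealD(1)[OF M]] MS]
  have "?S = carrier A"
  proof
    assume "?S = M"
    with IS I(2) show ?thesis by simp
  qed
  with a have "a \<in> ?S" by simp
  then show ?thesis by blast
qed

text \<open>The key step, where operations of arity at least two are used. If neither \<open>I\<close> nor \<open>J\<close> lies in
  \<open>M\<close>, then \<open>A = I + M = J + M\<close>. Take a value of an operation outside \<open>M\<close>, and split its first
  argument along \<open>I + M\<close> and its second along \<open>J + M\<close>. Modulo \<open>M\<close> only the term with an argument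
  in \<open>I\<close> and an argument in \<open>J\<close> remains, and this term lies in \<open>I \<inter> J \<subseteq> M\<close>.\<close>

lemma cosimple_ideal_prime:
  assumes M: "cosimple_ideal F C A M" and I: "alg_ideal F C A I" and J: "alg_ideal F C A J"
    and IJ: "I \<inter> J \<subseteq> M"
  shows "I \<subseteq> M \<or> J \<subseteq> M"
proof (rule ccontr)
  assume "\<not> (I \<subseteq> M \<or> J \<subseteq> M)"
  then have nI: "\<not> I \<subseteq> M" and nJ: "\<not> J \<subseteq> M" by auto
  note I' = alg_idealD[OF I] and J' = alg_idealD[OF J] and M' = alg_idealD[OF cosimple_idealD(1)[OF M]]
  obtain n c xs where n: "n \<ge> 2" and c: "c \<in> opers C n" and xs: "xs \<in> lists (carrier A)" "length xs = n"
    and notin: "opn A n c xs \<notin> M"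
    using M by (auto simp: cosimple_ideal_def)
  obtain u v ys where xs_eq: "xs = u # v # ys"
    using n xs(2) by (metis Suc_le_length_iff numeral_2_eq_2)
  have uv: "u \<in> carrier A" "v \<in> carrier A" "ys \<in> lists (carrier A)" and len: "n = Suc (Suc (length ys))"
    using xs xs_eq by auto
  obtain i m where i: "i \<in> I" and m: "m \<in> M" and u: "u = i \<oplus>\<^bsub>A\<^esub> m"
    using cosimple_ideal_complement[OF M I nI uv(1)] by blast
  obtain j m' where j: "j \<in> J" and m': "m' \<in> M" and v: "v = j \<oplus>\<^bsub>A\<^esub> m'"
    using cosimple_ideal_complement[OF M J nJ uv(2)] by blast
  have car: "i \<in> carrier A" "j \<in> carrier A" "m \<in> carrier A" "m' \<in> carrier A"
    using i j m m' I'(1) J'(1) M'(1) by auto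
  have "opn A n c xs = opn A n c (i # v # ys) \<oplus>\<^bsub>A\<^esub> opn A n c (m # v # ys)"
    using linear_mapD(4)[OF opn_slot[OF c, of "[]" "v # ys"], of i m] car uv len
    by (simp add: xs_eq u)
  also have "opn A n c (i # v # ys) = opn A n c (i # j # ys) \<oplus>\<^bsub>A\<^esub> opn A n c (i # m' # ys)"
    using linear_mapD(4)[OF opn_slot[OF c, of "[i]" "ys"], of j m'] car uv len
    by (simp add: v)
  finally have eq: "opn A n c xs = (opn A n c (i # j # ys) \<oplus>\<^bsub>A\<^esub> opn A n c (i # m' # ys)) \<oplus>\<^bsub>A\<^esub> opn A n c (m # v # ys)" .
  have "opn A n c (i # j # ys) \<in> I"
    using I'(7)[OF c, of "[]" i "j # ys"] i car uv len by simp
  moreover have "opn A n c (i # j # ys) \<in> J"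
    using J'(7)[OF c, of "[i]" j ys] j car uv len by simp
  ultimately have "opn A n c (i # j # ys) \<in> M" using IJ by blast
  moreover have "opn A n c (i # m' # ys) \<in> M"
    using M'(7)[OF c, of "[i]" m' ys] m' car uv len by simp
  moreover have "opn A n c (m # v # ys) \<in> M"
    using M'(7)[OF c, of "[]" m "v # ys"] m car uv len by simp
  ultimately show False using M'(3) notin unfolding eq by blast
qed

lemma cosimple_ideal_prime_Inter:
  assumes M: "cosimple_ideal F C A M" and fin: "finite S"
    and I: "\<And>i. i \<in> S \<Longrightarrow> alg_ideal F C A (I i)"
    and sub: "carrier A \<inter> (\<Inter>i\<in>S. I i) \<subseteq> M"
  shows "\<exists>i\<in>S. I i \<subseteq> M"
  using fin I sub
proof (induction S)
  case empty
  then show ?case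
    using cosimple_idealD(3)[OF M] alg_idealD(1)[OF cosimple_idealD(1)[OF M]] by auto
next
  case (insert i S)
  have "alg_ideal F C A (carrier A \<inter> (\<Inter>i\<in>S. I i))"
    using insert.prems(1) by (intro alg_ideal_Inter) auto
  moreover have "I i \<inter> (carrier A \<inter> (\<Inter>i\<in>S. I i)) \<subseteq> M"
    using insert.prems(2) by auto
  ultimately have "I i \<subseteq> M \<or> carrier A \<inter> (\<Inter>i\<in>S. I i) \<subseteq> M"
    using cosimple_ideal_prime[OF M insert.prems(1)[of i]] by blast
  then show ?case using insert.IH insert.prems(1) by blast
qed

text \<open>The Chinese remainder theorem. Two distinct ideals of the family do not contain each other, so by
  primality the intersection of those already treated is not contained in a new one \<open>M\<^sub>s\<close>; hence it
  contains an element by which a solution can be corrected modulo \<open>M\<^sub>s\<close> alone. Indices with equal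
  ideals are allowed if their requirements agree: in the application the index set is a group and the
  ideal depends on a coset.\<close>

lemma cosimple_ideals_remainder:
  assumes fin: "finite S" and M: "\<And>s. s \<in> S \<Longrightarrow> cosimple_ideal F C A (M s)"
    and a: "\<And>s. s \<in> S \<Longrightarrow> a s \<in> carrier A"
    and consistent: "\<And>s t. \<lbrakk>s \<in> S; t \<in> S; M s = M t\<rbrakk> \<Longrightarrow> a s \<ominus>\<^bsub>A\<^esub> a t \<in> M s"
  shows "\<exists>x\<in>carrier A. \<forall>s\<in>S. x \<ominus>\<^bsub>A\<^esub> a s \<in> M s"
  using fin M a consistent
proof (induction S)
  case empty
  then show ?case by auto
next
  case (insert s S)
  then obtain x where x: "x \<in> carrier A" and xS: "\<And>t. t \<in> S \<Longrightarrow> x \<ominus>\<^bsub>A\<^esub> a t \<in> M t"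
    by auto
  have Ms: "cosimple_ideal F C A (M s)" and as: "a s \<in> carrier A"
    using insert.prems by auto
  have ideal: "alg_ideal F C A (M t)" if "t \<in> insert s S" for t
    using cosimple_idealD(1)[OF insert.prems(1)[OF that]] .
  note Ms' = alg_idealD[OF ideal[of s]]
  show ?case
  proof (cases "\<exists>t\<in>S. M t = M s")
    case True
    then obtain t where t: "t \<in> S" "M t = M s" by blast
    have at: "a t \<in> carrier A" using t insert.prems by auto
    have "a t \<ominus>\<^bsub>A\<^esub> a s \<in> M s"
      using insert.prems(3)[of t s] t by auto
    then have "(x \<ominus>\<^bsub>A\<^esub> a t) \<oplus>\<^bsub>A\<^esub> (a t \<ominus>\<^bsub>A\<^esub> a s) \<in> M s"
      using xS[OF t(1)] t(2) Ms'(3) by simp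
    also have "(x \<ominus>\<^bsub>A\<^esub> a t) \<oplus>\<^bsub>A\<^esub> (a t \<ominus>\<^bsub>A\<^esub> a s) = x \<ominus>\<^bsub>A\<^esub> a s"
      using x as at by (simp add: a_minus_def alg.M.add.m_assoc alg.M.r_neg1)
    finally show ?thesis using x xS by blast
  next
    case False
    let ?N = "carrier A \<inter> (\<Inter>t\<in>S. M t)"
    have N: "alg_ideal F C A ?N" using ideal by (intro alg_ideal_Inter) auto
    have "\<not> M t \<subseteq> M s" if t: "t \<in> S" for t
      using cosimple_idealD(2)[OF insert.prems(1)[of t] ideal[of s]] cosimple_idealD(3)[OF Ms]
        False t by auto
    then have "\<not> ?N \<subseteq> M s"
      using cosimple_ideal_prime_Inter[OF Ms insert.hyps(1), of M] ideal by blast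
    then obtain y m where y: "y \<in> ?N" and m: "m \<in> M s" and eq: "a s \<ominus>\<^bsub>A\<^esub> x = y \<oplus>\<^bsub>A\<^esub> m"
      using cosimple_ideal_complement[OF Ms N, of "a s \<ominus>\<^bsub>A\<^esub> x"] as x by auto
    have car: "y \<in> carrier A" "m \<in> carrier A" using y m Ms'(1) by auto
    have "x \<oplus>\<^bsub>A\<^esub> y \<ominus>\<^bsub>A\<^esub> a t \<in> M t" if t: "t \<in> S" for t
    proof -
      have "a t \<in> carrier A" using t insert.prems by auto
      then have "x \<oplus>\<^bsub>A\<^esub> y \<ominus>\<^bsub>A\<^esub> a t = (x \<ominus>\<^bsub>A\<^esub> a t) \<oplus>\<^bsub>A\<^esub> y"
        using x car by (simp add: a_minus_def alg.M.add.m_ac)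
      also have "\<dots> \<in> M t"
        using y t by (intro alg_idealD(3)[OF ideal] xS) auto
      finally show ?thesis .
    qed
    moreover have "x \<oplus>\<^bsub>A\<^esub> y \<ominus>\<^bsub>A\<^esub> a s \<in> M s"
    proof -
      have "(x \<oplus>\<^bsub>A\<^esub> y \<ominus>\<^bsub>A\<^esub> a s) \<oplus>\<^bsub>A\<^esub> m = (y \<oplus>\<^bsub>A\<^esub> m) \<oplus>\<^bsub>A\<^esub> (x \<ominus>\<^bsub>A\<^esub> a s)"
        using x as car by (simp add: a_minus_def alg.M.add.m_ac)
      also have "\<dots> = \<zero>\<^bsub>A\<^esub>"
        using x as unfolding eq[symmetric]
        by (simp add: a_minus_def alg.M.add.m_assoc alg.M.r_neg1 alg.M.r_neg)
      finally have "x \<oplus>\<^bsub>A\<^esub> y \<ominus>\<^bsub>A\<^esub> a s = \<ominus>\<^bsub>A\<^esub> m"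
        using x as car by (intro alg.M.minus_equality[symmetric]) auto
      then show ?thesis using Ms'(5) m by simp
    qed
    ultimately show ?thesis using x car by (intro bexI[of _ "x \<oplus>\<^bsub>A\<^esub> y"]) auto
  qed
qed

end

section \<open>Induced algebras and their quotients\<close>

lemma hom_alg_AutD:
  assumes "group G" and \<phi>: "\<phi> \<in> hom G (alg_Aut F C A)"
  shows "g \<in> carrier G \<Longrightarrow> \<phi> g \<in> alg_hom F C A A"
    and "g \<in> carrier G \<Longrightarrow> bij_betw (\<phi> g) (carrier A) (carrier A)"
    and "\<lbrakk>g \<in> carrier G; h \<in> carrier G; a \<in> carrier A\<rbrakk> \<Longrightarrow> \<phi> (g \<otimes>\<^bsub>G\<^esub> h) a = \<phi> g (\<phi> h a)"
    and "a \<in> carrier A \<Longrightarrow> \<phi> \<one>\<^bsub>G\<^esub> a = a"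
proof -
  interpret group G by (rule assms(1))
  have mem: "\<phi> g \<in> alg_hom F C A A \<inter> Bij (carrier A)" if "g \<in> carrier G" for g
    using hom_in_carrier[OF \<phi> that] by (simp add: alg_Aut_def)
  show "g \<in> carrier G \<Longrightarrow> \<phi> g \<in> alg_hom F C A A" for g
    using mem by auto
  show bij: "g \<in> carrier G \<Longrightarrow> bij_betw (\<phi> g) (carrier A) (carrier A)" for g
    using mem by (auto simp: Bij_def)
  show comp: "\<lbrakk>g \<in> carrier G; h \<in> carrier G; a \<in> carrier A\<rbrakk> \<Longrightarrow> \<phi> (g \<otimes>\<^bsub>G\<^esub> h) a = \<phi> g (\<phi> h a)" for g h a
    using hom_mult[OF \<phi>, of g h] mem[of g] mem[of h]
    by (simp add: alg_Aut_def BijGroup_def compose_def)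
  show "a \<in> carrier A \<Longrightarrow> \<phi> \<one>\<^bsub>G\<^esub> a = a"
    using comp[OF one_closed one_closed, of a] bij[OF one_closed]
    by (auto simp: bij_betw_def dest!: inj_onD)
qed

text \<open>The inverse of \<open>\<phi>(g)\<close> is \<open>\<phi>(g\<^sup>-\<^sup>1)\<close>, so bijectivity comes for free.\<close>

lemma hom_alg_AutI:
  assumes "group G"
    and hom: "\<And>g. g \<in> carrier G \<Longrightarrow> \<phi> g \<in> alg_hom F C A A"
    and ext: "\<And>g. g \<in> carrier G \<Longrightarrow> \<phi> g \<in> extensional (carrier A)"
    and comp: "\<And>g h a. \<lbrakk>g \<in> carrier G; h \<in> carrier G; a \<in> carrier A\<rbrakk> \<Longrightarrow> \<phi> (g \<otimes>\<^bsub>G\<^esub> h) a = \<phi> g (\<phi> h a)"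
    and one: "\<And>a. a \<in> carrier A \<Longrightarrow> \<phi> \<one>\<^bsub>G\<^esub> a = a"
  shows "\<phi> \<in> hom G (alg_Aut F C A)"
proof -
  interpret group G by (rule assms(1))
  have cl: "\<phi> g a \<in> carrier A" if "g \<in> carrier G" "a \<in> carrier A" for g a
    using linear_mapD(3)[OF alg_homD(1)[OF hom]] that by blast
  have inv: "\<phi> (inv\<^bsub>G\<^esub> g) (\<phi> g a) = a" "\<phi> g (\<phi> (inv\<^bsub>G\<^esub> g) a) = a"
    if "g \<in> carrier G" "a \<in> carrier A" for g a
    using that by (simp_all add: one flip: comp)
  have "bij_betw (\<phi> g) (carrier A) (carrier A)" if "g \<in> carrier G" for g
    using that cl inv by (intro bij_betw_byWitness[where f' = "\<phi> (inv\<^bsub>G\<^esub> g)"]) auto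
  then have Bij: "\<phi> g \<in> Bij (carrier A)" if "g \<in> carrier G" for g
    using that ext by (simp add: Bij_def)
  have "\<phi> (g \<otimes>\<^bsub>G\<^esub> h) = compose (carrier A) (\<phi> g) (\<phi> h)" if "g \<in> carrier G" "h \<in> carrier G" for g h
    using that by (intro extensionalityI[OF ext compose_extensional]) (auto simp: comp compose_eq)
  then show ?thesis
    using Bij hom by (auto simp: hom_def alg_Aut_def BijGroup_def)
qed

text \<open>Presentations of \<open>A\<close> as \<open>Fun\<^sub>H(G,B)\<close> amount to epimorphisms \<open>p : A \<rightarrow> B\<close> of the kind described
  here: evaluation of functions at \<open>1\<close> in one direction, and \<open>a \<mapsto> (x \<mapsto> p(xa))\<close> in the other. The
  conditions say that \<open>p\<close> is \<open>H\<close>-equivariant, that \<open>H\<close> contains every element that maps the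
  kernel of \<open>p\<close> into itself, and that the translates of this kernel intersect in zero.\<close>

definition induced_quotient ::
  "('k, 'm) ring_scheme \<Rightarrow> ('k, 'c) operad \<Rightarrow> ('g, 'n) monoid_scheme \<Rightarrow>
    ('k, 'c, 'a) operad_alg \<Rightarrow> ('g \<Rightarrow> 'a \<Rightarrow> 'a) \<Rightarrow>
    'g set \<Rightarrow> ('k, 'c, 'b) operad_alg \<Rightarrow> ('g \<Rightarrow> 'b \<Rightarrow> 'b) \<Rightarrow> ('a \<Rightarrow> 'b) \<Rightarrow> bool" where
  "induced_quotient F C G A \<rho> H B \<phi> p \<longleftrightarrow>
     p \<in> alg_hom F C A B \<and> p ` carrier A = carrier B \<and>
     (\<forall>h\<in>H. \<forall>a\<in>carrier A. p (\<rho> h a) = \<phi> h (p a)) \<and>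
     (\<forall>g\<in>carrier G. (\<forall>a\<in>carrier A. p a = \<zero>\<^bsub>B\<^esub> \<longrightarrow> p (\<rho> g a) = \<zero>\<^bsub>B\<^esub>) \<longrightarrow> g \<in> H) \<and>
     (\<forall>a\<in>carrier A. (\<forall>g\<in>carrier G. p (\<rho> g a) = \<zero>\<^bsub>B\<^esub>) \<longrightarrow> a = \<zero>\<^bsub>A\<^esub>)"

lemma induced_quotientD:
  assumes "induced_quotient F C G A \<rho> H B \<phi> p"
  shows "p \<in> alg_hom F C A B" "p ` carrier A = carrier B"
    and "\<lbrakk>h \<in> H; a \<in> carrier A\<rbrakk> \<Longrightarrow> p (\<rho> h a) = \<phi> h (p a)"
    and "\<lbrakk>g \<in> carrier G; \<And>a. \<lbrakk>a \<in> carrier A; p a = \<zero>\<^bsub>B\<^esub>\<rbrakk> \<Longrightarrow> p (\<rho> g a) = \<zero>\<^bsub>B\<^esub>\<rbrakk> \<Longrightarrow> g \<in> H"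
    and "\<lbrakk>a \<in> carrier A; \<And>g. g \<in> carrier G \<Longrightarrow> p (\<rho> g a) = \<zero>\<^bsub>B\<^esub>\<rbrakk> \<Longrightarrow> a = \<zero>\<^bsub>A\<^esub>"
  using assms by (auto simp: induced_quotient_def)

text \<open>Functions supported on a single coset \<open>Hy\<close> show that evaluation at \<open>1\<close> is surjective and that
  only elements of \<open>H\<close> preserve its kernel: for \<open>g \<notin> H\<close> there is a function that vanishes at \<open>1\<close>
  but not at \<open>g\<close>.\<close>

lemma induced_quotient_if_presentation:
  assumes G: "group G" and pres: "induced_presentation F C G A \<rho> H B \<phi>"
    and A: "equivariant_algebra F C G A \<rho>"
  shows "\<exists>p. induced_quotient F C G A \<rho> H B \<phi> p"
proof -
  interpret group G by (rule G)
  interpret A: operad_algebra F C A using A by (simp add: equivariant_algebra_def)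
  have \<rho>: "\<rho> \<in> hom G (alg_Aut F C A)" using A by (simp add: equivariant_algebra_def)
  note \<rho>' = hom_alg_AutD[OF G \<rho>]
  have H: "subgroup H G" and B: "simple_algebra F C B"
    and \<phi>: "\<phi> \<in> hom (G\<lparr>carrier := H\<rparr>) (alg_Aut F C B)"
    using pres by (auto simp: induced_presentation_def)
  interpret B: operad_algebra F C B using B by (simp add: simple_algebra_def)
  interpret H: subgroup H G by (rule H)
  note \<phi>' = hom_alg_AutD[OF H.subgroup_is_group[OF G] \<phi>, simplified]
  let ?Fun = "Fun_alg G H B \<phi>"
  obtain \<theta> where "\<theta> \<in> equivariant_iso F C G A \<rho> ?Fun (Fun_action G H B \<phi>)"
    using pres by (auto simp: induced_presentation_def)
  then have \<theta>: "\<theta> \<in> alg_hom F C A ?Fun" and bij: "bij_betw \<theta> (carrier A) (carrier ?Fun)"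
    and equiv: "\<And>g a. \<lbrakk>g \<in> carrier G; a \<in> carrier A\<rbrakk> \<Longrightarrow> \<theta> (\<rho> g a) = Fun_action G H B \<phi> g (\<theta> a)"
    by (auto simp: equivariant_iso_def alg_iso_def)
  note \<theta>' = linear_mapD[OF alg_homD(1)[OF \<theta>]]
  define p where "p a = \<theta> a \<one>\<^bsub>G\<^esub>" for a
  have \<theta>_B: "\<theta> a x \<in> carrier B" if "a \<in> carrier A" "x \<in> carrier G" for a x
    using \<theta>'(3)[OF that(1)] that(2) by (auto simp: Fun_alg_def)
  have p_\<rho>: "p (\<rho> g a) = \<theta> a g" if "g \<in> carrier G" "a \<in> carrier A" for g a
    using that \<theta>'(3)[OF that(2)] by (simp add: p_def equiv Fun_action_def)
  have p: "p \<in> alg_hom F C A B"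
  proof (rule alg_homI, rule linear_mapI[OF A.alg_vectorspace B.alg_vectorspace])
    show "p a \<in> carrier B" if "a \<in> carrier A" for a
      using \<theta>_B that by (simp add: p_def)
    show "p (a \<oplus>\<^bsub>A\<^esub> b) = p a \<oplus>\<^bsub>B\<^esub> p b" if "a \<in> carrier A" "b \<in> carrier A" for a b
      using that by (simp add: p_def \<theta>'(4)) (simp add: Fun_alg_def)
    show "p (k \<odot>\<^bsub>A\<^esub> a) = k \<odot>\<^bsub>B\<^esub> p a" if "k \<in> carrier F" "a \<in> carrier A" for k a
      using that by (simp add: p_def \<theta>'(5)) (simp add: Fun_alg_def)
    show "p (opn A n c xs) = opn B n c (map p xs)"
      if "c \<in> opers C n" "xs \<in> lists (carrier A)" "length xs = n" for n c xs
      unfolding p_def alg_homD(2)[OF \<theta> that] by (simp add: Fun_alg_def comp_def)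
  qed
  \<comment> \<open>\<open>\<delta> y b\<close> is the function supported on \<open>Hy\<close> with value \<open>b\<close> at \<open>y\<close>.\<close>
  define \<delta> where "\<delta> y b = (\<lambda>z\<in>carrier G. if z \<otimes>\<^bsub>G\<^esub> inv\<^bsub>G\<^esub> y \<in> H then \<phi> (z \<otimes>\<^bsub>G\<^esub> inv\<^bsub>G\<^esub> y) b else \<zero>\<^bsub>B\<^esub>)" for y b
  have "\<delta> y b \<in> carrier ?Fun" if y: "y \<in> carrier G" and b: "b \<in> carrier B" for y b
  proof -
    have "\<phi> h b \<in> carrier B" if "h \<in> H" for h
      using bij_betwE[OF \<phi>'(2)[OF that]] b by blast
    moreover have "\<delta> y b (h \<otimes>\<^bsub>G\<^esub> x) = \<phi> h (\<delta> y b x)" if h: "h \<in> H" and x: "x \<in> carrier G" for h x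
    proof -
      have xy: "x \<otimes>\<^bsub>G\<^esub> inv\<^bsub>G\<^esub> y \<in> carrier G" using x y by simp
      have assoc: "h \<otimes>\<^bsub>G\<^esub> x \<otimes>\<^bsub>G\<^esub> inv\<^bsub>G\<^esub> y = h \<otimes>\<^bsub>G\<^esub> (x \<otimes>\<^bsub>G\<^esub> inv\<^bsub>G\<^esub> y)"
        using h x y by (simp add: m_assoc)
      have iff: "h \<otimes>\<^bsub>G\<^esub> (x \<otimes>\<^bsub>G\<^esub> inv\<^bsub>G\<^esub> y) \<in> H \<longleftrightarrow> x \<otimes>\<^bsub>G\<^esub> inv\<^bsub>G\<^esub> y \<in> H"
      proof
        assume "h \<otimes>\<^bsub>G\<^esub> (x \<otimes>\<^bsub>G\<^esub> inv\<^bsub>G\<^esub> y) \<in> H"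
        then have "inv\<^bsub>G\<^esub> h \<otimes>\<^bsub>G\<^esub> (h \<otimes>\<^bsub>G\<^esub> (x \<otimes>\<^bsub>G\<^esub> inv\<^bsub>G\<^esub> y)) \<in> H" using h by simp
        then show "x \<otimes>\<^bsub>G\<^esub> inv\<^bsub>G\<^esub> y \<in> H" using h xy by (simp add: inv_solve_left flip: m_assoc)
      qed (use h in simp)
      have "\<phi> h \<zero>\<^bsub>B\<^esub> = \<zero>\<^bsub>B\<^esub>"
        using linear_mapD(6)[OF alg_homD(1)[OF \<phi>'(1)[OF h]]] .
      then show ?thesis
        using h x b by (simp add: \<delta>_def assoc iff \<phi>'(3))
    qed
    ultimately show ?thesis by (auto simp: Fun_alg_def \<delta>_def)
  qed
  then have \<delta>_image: "\<exists>a\<in>carrier A. \<theta> a = \<delta> y b" if "y \<in> carrier G" "b \<in> carrier B" for y b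
    using bij that by (metis bij_betw_imp_surj_on imageE)
  have "induced_quotient F C G A \<rho> H B \<phi> p"
    unfolding induced_quotient_def
  proof (intro conjI ballI impI p)
    show "p ` carrier A = carrier B"
    proof (intro equalityI subsetI)
      fix b assume b: "b \<in> carrier B"
      obtain a where a: "a \<in> carrier A" "\<theta> a = \<delta> \<one>\<^bsub>G\<^esub> b" using \<delta>_image[OF one_closed b] by blast
      then have "p a = b" using b by (simp add: p_def \<delta>_def \<phi>'(4))
      then show "b \<in> p ` carrier A" using a(1) by blast
    qed (use linear_mapD(3)[OF alg_homD(1)[OF p]] in auto)
    show "p (\<rho> h a) = \<phi> h (p a)" if h: "h \<in> H" and a: "a \<in> carrier A" for h a
    proof -
      have "\<theta> a (h \<otimes>\<^bsub>G\<^esub> x) = \<phi> h (\<theta> a x)" if "x \<in> carrier G" for x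
        using \<theta>'(3)[OF a] h that by (simp add: Fun_alg_def)
      from this[OF one_closed] show ?thesis
        using h p_\<rho>[OF _ a, of h] by (simp add: p_def)
    qed
    show "g \<in> H"
      if g: "g \<in> carrier G" and stab: "\<forall>a\<in>carrier A. p a = \<zero>\<^bsub>B\<^esub> \<longrightarrow> p (\<rho> g a) = \<zero>\<^bsub>B\<^esub>" for g
    proof (rule ccontr)
      assume gH: "g \<notin> H"
      obtain b where b: "b \<in> carrier B" "b \<noteq> \<zero>\<^bsub>B\<^esub>"
        using B B.E_space_nonzero_iff B.opn_closed unfolding simple_algebra_def by blast
      obtain a where a: "a \<in> carrier A" "\<theta> a = \<delta> g b" using \<delta>_image[OF g b(1)] by blast
      have "inv\<^bsub>G\<^esub> g \<notin> H" using gH g H.m_inv_closed[of "inv\<^bsub>G\<^esub> g"] by auto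
      then have "p a = \<zero>\<^bsub>B\<^esub>" using a g by (simp add: p_def \<delta>_def)
      then have "\<theta> a g = \<zero>\<^bsub>B\<^esub>" using stab a(1) p_\<rho>[OF g a(1)] by simp
      then show False using a(2) b g by (simp add: \<delta>_def \<phi>'(4) r_inv)
    qed
    show "a = \<zero>\<^bsub>A\<^esub>"
      if a: "a \<in> carrier A" and zero: "\<forall>g\<in>carrier G. p (\<rho> g a) = \<zero>\<^bsub>B\<^esub>" for a
    proof -
      have "\<theta> a = \<theta> \<zero>\<^bsub>A\<^esub>"
        unfolding \<theta>'(6)
      proof (rule extensionalityI)
        show "\<theta> a \<in> extensional (carrier G)" using \<theta>'(3)[OF a] by (auto simp: Fun_alg_def PiE_def)
        show "\<zero>\<^bsub>?Fun\<^esub> \<in> extensional (carrier G)" by (simp add: Fun_alg_def)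
        show "\<theta> a x = \<zero>\<^bsub>?Fun\<^esub> x" if "x \<in> carrier G" for x
          using zero p_\<rho>[OF that a] that by (simp add: Fun_alg_def)
      qed
      then show ?thesis
        using bij a A.alg.M.zero_closed by (metis bij_betw_imp_inj_on inj_onD)
    qed
  qed
  then show ?thesis by blast
qed

text \<open>The map \<open>a \<mapsto> (x \<mapsto> p(xa))\<close> is injective because the kernels \<open>M\<^sub>x\<close> of \<open>a \<mapsto> p(xa)\<close> intersect in
  zero, and surjective by the Chinese remainder theorem for these kernels. The consistency condition
  holds because \<open>M\<^sub>x = M\<^sub>y\<close> only if \<open>xy\<^sup>-\<^sup>1\<close> stabilizes the kernel of \<open>p\<close>, that is, lies in \<open>H\<close>, and
  then the prescribed values at \<open>x\<close> and \<open>y\<close> determine each other.\<close>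

lemma presentation_if_induced_quotient:
  assumes G: "group G" and fin: "finite (carrier G)"
    and A: "equivariant_algebra F C G A \<rho>"
    and H: "subgroup H G" and B: "simple_algebra F C B"
    and \<phi>: "\<phi> \<in> hom (G\<lparr>carrier := H\<rparr>) (alg_Aut F C B)"
    and q: "induced_quotient F C G A \<rho> H B \<phi> p"
  shows "induced_presentation F C G A \<rho> H B \<phi>"
proof -
  interpret group G by (rule G)
  interpret A: operad_algebra F C A using A by (simp add: equivariant_algebra_def)
  interpret B: operad_algebra F C B using B by (simp add: simple_algebra_def)
  interpret H: subgroup H G by (rule H)
  have \<rho>: "\<rho> \<in> hom G (alg_Aut F C A)" using A by (simp add: equivariant_algebra_def)
  note \<rho>' = hom_alg_AutD[OF G \<rho>] and q' = induced_quotientD[OF q]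
  have \<rho>_cl: "\<rho> g a \<in> carrier A" if "g \<in> carrier G" "a \<in> carrier A" for g a
    using bij_betwE[OF \<rho>'(2)[OF that(1)]] that(2) by blast
  have \<rho>_inv: "\<rho> g (\<rho> (inv\<^bsub>G\<^esub> g) a) = a" if "g \<in> carrier G" "a \<in> carrier A" for g a
    using that by (simp add: \<rho>'(4) flip: \<rho>'(3))
  note p = q'(1) and surj = q'(2)
  note p' = linear_mapD[OF alg_homD(1)[OF p]]
  have p\<rho>: "(\<lambda>a. p (\<rho> x a)) \<in> alg_hom F C A B" if "x \<in> carrier G" for x
    by (rule alg_hom_comp[OF \<rho>'(1)[OF that] p])
  have p\<rho>_surj: "(\<lambda>a. p (\<rho> x a)) ` carrier A = carrier B" if "x \<in> carrier G" for x
    using \<rho>'(2)[OF that] surj by (metis bij_betw_imp_surj_on image_image)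
  let ?Fun = "Fun_alg G H B \<phi>"
  define \<theta> where "\<theta> a = (\<lambda>x\<in>carrier G. p (\<rho> x a))" for a
  have \<theta>_Fun: "\<theta> a \<in> carrier ?Fun" if a: "a \<in> carrier A" for a
    using a \<rho>_cl p'(3) q'(3) by (auto simp: Fun_alg_def \<theta>_def \<rho>'(3))
  have onto: "f \<in> \<theta> ` carrier A" if f: "f \<in> carrier ?Fun" for f
  proof -
    have f': "f \<in> extensional (carrier G)" "\<And>x. x \<in> carrier G \<Longrightarrow> f x \<in> carrier B"
      "\<And>h x. \<lbrakk>h \<in> H; x \<in> carrier G\<rbrakk> \<Longrightarrow> f (h \<otimes>\<^bsub>G\<^esub> x) = \<phi> h (f x)"
      using f by (auto simp: Fun_alg_def PiE_def)
    define M where "M x = {a \<in> carrier A. p (\<rho> x a) = \<zero>\<^bsub>B\<^esub>}" for x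
    have M: "cosimple_ideal F C A (M x)" if "x \<in> carrier G" for x
      unfolding M_def by (rule A.cosimple_ideal_ker[OF p\<rho>[OF that] p\<rho>_surj[OF that] B])
    have "\<forall>x\<in>carrier G. \<exists>a. a \<in> carrier A \<and> p (\<rho> x a) = f x"
      using f'(2) p\<rho>_surj by (metis (no_types, lifting) imageE)
    then obtain a where a: "\<And>x. x \<in> carrier G \<Longrightarrow> a x \<in> carrier A"
      "\<And>x. x \<in> carrier G \<Longrightarrow> p (\<rho> x (a x)) = f x"
      by (auto simp: bchoice_iff)
    have diff: "u \<ominus>\<^bsub>A\<^esub> v \<in> M x \<longleftrightarrow> p (\<rho> x u) = p (\<rho> x v)"
      if "x \<in> carrier G" "u \<in> carrier A" "v \<in> carrier A" for x u v
      using that linear_mapD(3,7)[OF alg_homD(1)[OF p\<rho>[OF that(1)]]]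
      by (simp add: M_def B.alg.minus_eq_zero_iff)
    have consistent: "a x \<ominus>\<^bsub>A\<^esub> a y \<in> M x"
      if x: "x \<in> carrier G" and y: "y \<in> carrier G" and eq: "M x = M y" for x y
    proof -
      define h where "h = x \<otimes>\<^bsub>G\<^esub> inv\<^bsub>G\<^esub> y"
      have h: "h \<in> carrier G" and x_eq: "x = h \<otimes>\<^bsub>G\<^esub> y"
        using x y by (simp_all add: h_def m_assoc)
      have "h \<in> H"
      proof (rule q'(4)[OF h])
        fix b assume b: "b \<in> carrier A" "p b = \<zero>\<^bsub>B\<^esub>"
        have cl: "\<rho> (inv\<^bsub>G\<^esub> y) b \<in> carrier A" using y b by (simp add: \<rho>_cl)
        then have "\<rho> (inv\<^bsub>G\<^esub> y) b \<in> M y" using y b by (simp add: M_def \<rho>_inv)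
        then have "p (\<rho> x (\<rho> (inv\<^bsub>G\<^esub> y) b)) = \<zero>\<^bsub>B\<^esub>" using eq by (auto simp: M_def)
        then show "p (\<rho> h b) = \<zero>\<^bsub>B\<^esub>"
          using x y b by (simp add: h_def \<rho>'(3))
      qed
      then have "f x = \<phi> h (p (\<rho> y (a y)))"
        using y f'(3) a(2) x_eq by simp
      also have "\<dots> = p (\<rho> h (\<rho> y (a y)))"
        using \<open>h \<in> H\<close> y a(1) by (simp add: q'(3) \<rho>_cl)
      also have "\<dots> = p (\<rho> x (a y))"
        using h y a(1) by (simp add: x_eq \<rho>'(3))
      finally show ?thesis using diff[OF x a(1)[OF x] a(1)[OF y]] a(2)[OF x] by simp
    qed
    have "\<exists>u\<in>carrier A. \<forall>x\<in>carrier G. u \<ominus>\<^bsub>A\<^esub> a x \<in> M x"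
      by (rule A.cosimple_ideals_remainder[OF fin M a(1) consistent])
    then obtain u where u: "u \<in> carrier A" "\<And>x. x \<in> carrier G \<Longrightarrow> u \<ominus>\<^bsub>A\<^esub> a x \<in> M x"
      by blast
    have "f = \<theta> u"
      using f'(1) u a diff by (intro extensionalityI[of f "carrier G"]) (auto simp: \<theta>_def)
    then show ?thesis using u(1) by blast
  qed
  then have surj\<theta>: "\<theta> ` carrier A = carrier ?Fun" using \<theta>_Fun by blast
  have "\<theta> \<in> alg_hom F C A ?Fun"
  proof (rule A.operad_algebra_surj_image(2)[OF surj\<theta>])
    note lin = linear_mapD[OF alg_homD(1)[OF p\<rho>]]
    show "\<theta> \<zero>\<^bsub>A\<^esub> = \<zero>\<^bsub>?Fun\<^esub>"
      by (simp add: Fun_alg_def \<theta>_def lin(6) cong: restrict_cong)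
    show "\<theta> (a \<oplus>\<^bsub>A\<^esub> b) = \<theta> a \<oplus>\<^bsub>?Fun\<^esub> \<theta> b" if "a \<in> carrier A" "b \<in> carrier A" for a b
      using that by (simp add: Fun_alg_def \<theta>_def lin(4) cong: restrict_cong)
    show "\<theta> (k \<odot>\<^bsub>A\<^esub> a) = k \<odot>\<^bsub>?Fun\<^esub> \<theta> a" if "k \<in> carrier F" "a \<in> carrier A" for k a
      using that by (simp add: Fun_alg_def \<theta>_def lin(5) cong: restrict_cong)
    show "\<theta> (opn A n c xs) = opn ?Fun n c (map \<theta> xs)"
      if c: "c \<in> opers C n" "xs \<in> lists (carrier A)" "length xs = n" for n c xs
      using alg_homD(2)[OF p\<rho> c] by (simp add: Fun_alg_def \<theta>_def comp_def cong: restrict_cong)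
  qed
  moreover have "inj_on \<theta> (carrier A)"
  proof (rule inj_onI)
    fix a b assume ab: "a \<in> carrier A" "b \<in> carrier A" and eq: "\<theta> a = \<theta> b"
    have "p (\<rho> g (a \<ominus>\<^bsub>A\<^esub> b)) = \<zero>\<^bsub>B\<^esub>" if g: "g \<in> carrier G" for g
      using fun_cong[OF eq, of g] g ab linear_mapD(3,7)[OF alg_homD(1)[OF p\<rho>[OF g]]]
      by (simp add: \<theta>_def B.alg.minus_eq_zero_iff)
    then have "a \<ominus>\<^bsub>A\<^esub> b = \<zero>\<^bsub>A\<^esub>" using ab by (intro q'(5)) auto
    then show "a = b" using ab by (simp add: A.alg.minus_eq_zero_iff)
  qed
  moreover have "\<theta> (\<rho> g a) = Fun_action G H B \<phi> g (\<theta> a)" if "g \<in> carrier G" "a \<in> carrier A" for g a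
    using that \<theta>_Fun[OF that(2)] by (simp add: Fun_action_def \<theta>_def \<rho>'(3) cong: restrict_cong)
  ultimately have "\<theta> \<in> equivariant_iso F C G A \<rho> ?Fun (Fun_action G H B \<phi>)"
    using surj\<theta> by (simp add: equivariant_iso_def alg_iso_def bij_betw_def)
  then show ?thesis using H B \<phi> by (auto simp: induced_presentation_def)
qed

section \<open>Existence and uniqueness of presentations\<close>

text \<open>The translates of a maximal ideal \<open>M\<close> intersect in an invariant ideal \<open>N\<close>, which is zero by
  simplicity. If all operations of arity at least two had their values in \<open>M\<close>, these values, being
  permuted by \<open>G\<close>, would lie in \<open>N = 0\<close>, contrary to \<open>E\<^sub>A \<noteq> 0\<close>.\<close>

lemma simple_equivariant_cosimple_ideal_exists:
  assumes G: "group G" and S: "simple_equivariant_algebra F C G A \<rho>"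
  shows "\<exists>M. cosimple_ideal F C A M \<and>
    (\<forall>a\<in>carrier A. (\<forall>g\<in>carrier G. \<rho> g a \<in> M) \<longrightarrow> a = \<zero>\<^bsub>A\<^esub>)"
proof -
  interpret group G by (rule G)
  interpret A: operad_algebra F C A
    using S by (simp add: simple_equivariant_algebra_def equivariant_algebra_def)
  have \<rho>: "\<rho> \<in> hom G (alg_Aut F C A)" and fin: "vectorspace.fin_dim F A"
    using S by (auto simp: simple_equivariant_algebra_def equivariant_algebra_def)
  note \<rho>' = hom_alg_AutD[OF G \<rho>]
  have \<rho>_cl: "\<rho> g a \<in> carrier A" if "g \<in> carrier G" "a \<in> carrier A" for g a
    using bij_betwE[OF \<rho>'(2)[OF that(1)]] that(2) by blast
  obtain n c xs where n: "n \<ge> 2" and c: "c \<in> opers C n"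
    and xs: "xs \<in> lists (carrier A)" "length xs = n" and nz: "opn A n c xs \<noteq> \<zero>\<^bsub>A\<^esub>"
    using S A.E_space_nonzero_iff by (auto simp: simple_equivariant_algebra_def)
  have "carrier A \<noteq> {\<zero>\<^bsub>A\<^esub>}" using A.opn_closed[OF c xs] nz by blast
  then obtain M where M: "alg_ideal F C A M" "M \<noteq> carrier A"
    and max: "\<And>J. \<lbrakk>alg_ideal F C A J; M \<subseteq> J\<rbrakk> \<Longrightarrow> J = M \<or> J = carrier A"
    using A.maximal_ideal_exists[OF fin A.alg_ideal_zero] by metis
  define N where "N = carrier A \<inter> (\<Inter>g\<in>carrier G. {a \<in> carrier A. \<rho> g a \<in> M})"
  have "alg_ideal F C A N"
    unfolding N_def
    by (intro A.alg_ideal_Inter A.alg_ideal_vimage[OF \<rho>'(1) A.operad_algebra_axioms M(1)])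
  moreover have "\<rho> g a \<in> N" if g: "g \<in> carrier G" and a: "a \<in> N" for g a
  proof -
    have "\<rho> h (\<rho> g a) \<in> M" if h: "h \<in> carrier G" for h
      using a g h by (auto simp: N_def simp flip: \<rho>'(3))
    then show ?thesis using a g by (auto simp: N_def \<rho>_cl)
  qed
  ultimately have "N = {\<zero>\<^bsub>A\<^esub>} \<or> N = carrier A"
    using S by (auto simp: simple_equivariant_algebra_def)
  moreover have "N \<subseteq> M" using \<rho>'(4) by (force simp: N_def)
  ultimately have N: "N = {\<zero>\<^bsub>A\<^esub>}"
    using M(2) A.alg_idealD(1)[OF M(1)] by blast
  have "\<exists>ys\<in>lists (carrier A). length ys = n \<and> opn A n c ys \<notin> M"
  proof (rule ccontr)
    assume "\<not> ?thesis"
    then have all: "opn A n c ys \<in> M" if "ys \<in> lists (carrier A)" "length ys = n" for ys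
      using that by blast
    have "\<rho> g (opn A n c xs) \<in> M" if g: "g \<in> carrier G" for g
    proof -
      have "map (\<rho> g) xs \<in> lists (carrier A)" using xs(1) \<rho>_cl[OF g] by auto
      then show ?thesis
        using all[of "map (\<rho> g) xs"] xs(2) alg_homD(2)[OF \<rho>'(1)[OF g] c xs] by simp
    qed
    then have "opn A n c xs \<in> N" using A.opn_closed[OF c xs] by (simp add: N_def)
    then show False using N nz by simp
  qed
  then have "cosimple_ideal F C A M"
    using M(1) max n c by (auto simp: cosimple_ideal_def)
  moreover have "a = \<zero>\<^bsub>A\<^esub>" if "a \<in> carrier A" "\<forall>g\<in>carrier G. \<rho> g a \<in> M" for a
    using that N by (auto simp: N_def)
  ultimately show ?thesis by blast
qed

lemma stabilizer_acts_on_quotient: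
  assumes G: "group G" and A: "equivariant_algebra F C G A \<rho>" and H: "subgroup H G"
    and B: "operad_algebra F C B"
    and p: "p \<in> alg_hom F C A B" and surj: "p ` carrier A = carrier B"
    and stable: "\<And>h a. \<lbrakk>h \<in> H; a \<in> carrier A; p a = \<zero>\<^bsub>B\<^esub>\<rbrakk> \<Longrightarrow> p (\<rho> h a) = \<zero>\<^bsub>B\<^esub>"
  shows "\<exists>\<phi>\<in>hom (G\<lparr>carrier := H\<rparr>) (alg_Aut F C B). \<forall>h\<in>H. \<forall>a\<in>carrier A. p (\<rho> h a) = \<phi> h (p a)"
proof -
  interpret group G by (rule G)
  interpret H: subgroup H G by (rule H)
  interpret A: operad_algebra F C A using A by (simp add: equivariant_algebra_def)
  interpret B: operad_algebra F C B by (rule B)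
  have \<rho>: "\<rho> \<in> hom G (alg_Aut F C A)" using A by (simp add: equivariant_algebra_def)
  note \<rho>' = hom_alg_AutD[OF G \<rho>] and p' = linear_mapD[OF alg_homD(1)[OF p]]
  have \<rho>_cl: "\<rho> g a \<in> carrier A" if "g \<in> carrier G" "a \<in> carrier A" for g a
    using bij_betwE[OF \<rho>'(2)[OF that(1)]] that(2) by blast
  have "\<exists>\<psi>\<in>alg_iso F C B B. \<forall>a\<in>carrier A. \<psi> (p a) = p (\<rho> h a)" if h: "h \<in> H" for h
  proof (rule alg_iso_from_equal_kernels[OF A.opn_closed p surj])
    have hG: "h \<in> carrier G" using h by simp
    show "(\<lambda>a. p (\<rho> h a)) \<in> alg_hom F C A B" by (rule alg_hom_comp[OF \<rho>'(1)[OF hG] p])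
    show "(\<lambda>a. p (\<rho> h a)) ` carrier A = carrier B"
      using \<rho>'(2)[OF hG] surj by (metis bij_betw_imp_surj_on image_image)
    show "p a = \<zero>\<^bsub>B\<^esub> \<longleftrightarrow> p (\<rho> h a) = \<zero>\<^bsub>B\<^esub>" if a: "a \<in> carrier A" for a
    proof
      assume "p (\<rho> h a) = \<zero>\<^bsub>B\<^esub>"
      then have "p (\<rho> (inv\<^bsub>G\<^esub> h) (\<rho> h a)) = \<zero>\<^bsub>B\<^esub>"
        using stable[of "inv\<^bsub>G\<^esub> h" "\<rho> h a"] h \<rho>_cl[OF hG a] by simp
      then show "p a = \<zero>\<^bsub>B\<^esub>" using hG a by (simp add: \<rho>'(4) flip: \<rho>'(3))
    qed (rule stable[OF h a])
  qed
  then obtain \<psi> where \<psi>: "\<And>h. h \<in> H \<Longrightarrow> \<psi> h \<in> alg_iso F C B B"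
    and \<psi>_p: "\<And>h a. \<lbrakk>h \<in> H; a \<in> carrier A\<rbrakk> \<Longrightarrow> \<psi> h (p a) = p (\<rho> h a)"
    by metis
  define \<phi> where "\<phi> h = (\<lambda>b\<in>carrier B. \<psi> h b)" for h
  have \<phi>_p: "\<phi> h (p a) = p (\<rho> h a)" if "h \<in> H" "a \<in> carrier A" for h a
    using that \<psi>_p p'(3) by (simp add: \<phi>_def)
  have "\<phi> \<in> hom (G\<lparr>carrier := H\<rparr>) (alg_Aut F C B)"
  proof (rule hom_alg_AutI[OF H.subgroup_is_group[OF G]]; simp)
    fix h assume h: "h \<in> H"
    have hom: "\<psi> h \<in> alg_hom F C B B" using \<psi>[OF h] by (simp add: alg_iso_def)
    note lin = linear_mapD[OF alg_homD(1)[OF hom]]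
    show "\<phi> h \<in> alg_hom F C B B"
    proof (rule alg_homI, rule linear_mapI[OF B.alg_vectorspace B.alg_vectorspace])
      show "\<phi> h (opn B n c xs) = opn B n c (map (\<phi> h) xs)"
        if "c \<in> opers C n" "xs \<in> lists (carrier B)" "length xs = n" for n c xs
      proof -
        have map: "map (\<phi> h) xs = map (\<psi> h) xs" using that(2) by (auto simp: \<phi>_def)
        show ?thesis
          unfolding map using alg_homD(2)[OF hom that] B.opn_closed[OF that] by (simp add: \<phi>_def)
      qed
    qed (simp_all add: \<phi>_def lin(3-5))
    show "\<phi> h \<in> extensional (carrier B)" by (simp add: \<phi>_def)
  next
    fix g h b assume gh: "g \<in> H" "h \<in> H" and "b \<in> carrier B"
    then obtain a where a: "a \<in> carrier A" "b = p a" using surj by blast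
    show "\<phi> (g \<otimes>\<^bsub>G\<^esub> h) b = \<phi> g (\<phi> h b)"
      using gh a by (simp add: \<phi>_p \<rho>'(3) \<rho>_cl)
  next
    fix b assume "b \<in> carrier B"
    then obtain a where a: "a \<in> carrier A" "b = p a" using surj by blast
    then show "\<phi> \<one>\<^bsub>G\<^esub> b = b" by (simp add: \<phi>_p \<rho>'(4))
  qed
  then show ?thesis using \<phi>_p by (intro bexI[of _ \<phi>]) auto
qed

text \<open>Here \<open>B\<close> is the quotient of \<open>A\<close> by a maximal ideal and \<open>H\<close> is the stabilizer of this ideal.\<close>

lemma induced_presentation_exists:
  fixes A :: "('k, 'c, 'a) operad_alg"
  assumes G: "group G" and fin: "finite (carrier G)" and S: "simple_equivariant_algebra F C G A \<rho>"
  shows "\<exists>H (B :: ('k, 'c, 'a) operad_alg) \<phi>. induced_presentation F C G A \<rho> H B \<phi>"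
proof -
  interpret group G by (rule G)
  have A: "equivariant_algebra F C G A \<rho>"
    using S by (simp add: simple_equivariant_algebra_def)
  interpret A: operad_algebra F C A using A by (simp add: equivariant_algebra_def)
  have \<rho>: "\<rho> \<in> hom G (alg_Aut F C A)" using A by (simp add: equivariant_algebra_def)
  note \<rho>' = hom_alg_AutD[OF G \<rho>]
  have \<rho>_cl: "\<rho> g a \<in> carrier A" if "g \<in> carrier G" "a \<in> carrier A" for g a
    using bij_betwE[OF \<rho>'(2)[OF that(1)]] that(2) by blast
  obtain M where M: "cosimple_ideal F C A M"
    and core: "\<And>a. \<lbrakk>a \<in> carrier A; \<And>g. g \<in> carrier G \<Longrightarrow> \<rho> g a \<in> M\<rbrakk> \<Longrightarrow> a = \<zero>\<^bsub>A\<^esub>"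
    using simple_equivariant_cosimple_ideal_exists[OF G S] by blast
  obtain B :: "('k, 'c, 'a) operad_alg" and p where B: "operad_algebra F C B"
    and p: "p \<in> alg_hom F C A B" and surj: "p ` carrier A = carrier B"
    and ker: "\<And>a. a \<in> carrier A \<Longrightarrow> p a = \<zero>\<^bsub>B\<^esub> \<longleftrightarrow> a \<in> M"
    using A.alg_quotient_exists[OF A.cosimple_idealD(1)[OF M]] by blast
  have simple: "simple_algebra F C B"
    using S by (intro A.simple_quotient[OF M _ p surj B ker]) (auto simp: simple_equivariant_algebra_def)
  define H where "H = {g \<in> carrier G. \<forall>a\<in>carrier A. \<rho> g a \<in> M \<longleftrightarrow> a \<in> M}"
  have H: "subgroup H G"
  proof (rule subgroup.intro)
    show "H \<subseteq> carrier G" by (auto simp: H_def)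
    show "g \<otimes>\<^bsub>G\<^esub> h \<in> H" if "g \<in> H" "h \<in> H" for g h
      using that \<rho>_cl by (auto simp: H_def \<rho>'(3))
    show "\<one>\<^bsub>G\<^esub> \<in> H" by (simp add: H_def \<rho>'(4))
    show "inv\<^bsub>G\<^esub> g \<in> H" if g: "g \<in> H" for g
    proof -
      have "\<rho> (inv\<^bsub>G\<^esub> g) a \<in> M \<longleftrightarrow> a \<in> M" if a: "a \<in> carrier A" for a
      proof -
        have gG: "g \<in> carrier G" using g by (simp add: H_def)
        then have eq: "\<rho> g (\<rho> (inv\<^bsub>G\<^esub> g) a) = a" using a by (simp add: \<rho>'(4) flip: \<rho>'(3))
        have "\<rho> (inv\<^bsub>G\<^esub> g) a \<in> carrier A" using gG a by (simp add: \<rho>_cl)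
        then have "\<rho> g (\<rho> (inv\<^bsub>G\<^esub> g) a) \<in> M \<longleftrightarrow> \<rho> (inv\<^bsub>G\<^esub> g) a \<in> M"
          using g unfolding H_def by blast
        then show ?thesis unfolding eq by blast
      qed
      then show ?thesis using g by (simp add: H_def)
    qed
  qed
  have "p (\<rho> h a) = \<zero>\<^bsub>B\<^esub>" if "h \<in> H" "a \<in> carrier A" "p a = \<zero>\<^bsub>B\<^esub>" for h a
    using that ker \<rho>_cl by (auto simp: H_def)
  then obtain \<phi> where \<phi>: "\<phi> \<in> hom (G\<lparr>carrier := H\<rparr>) (alg_Aut F C B)"
    and \<phi>_p: "\<And>h a. \<lbrakk>h \<in> H; a \<in> carrier A\<rbrakk> \<Longrightarrow> p (\<rho> h a) = \<phi> h (p a)"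
    using stabilizer_acts_on_quotient[OF G A H B p surj] by blast
  \<comment> \<open>An element that maps \<open>M\<close> into itself stabilizes \<open>M\<close>: its preimage of \<open>M\<close> is a proper ideal
    above \<open>M\<close>.\<close>
  have stab: "g \<in> H"
    if g: "g \<in> carrier G" and sub: "\<forall>a\<in>carrier A. p a = \<zero>\<^bsub>B\<^esub> \<longrightarrow> p (\<rho> g a) = \<zero>\<^bsub>B\<^esub>" for g
  proof -
    let ?M' = "{a \<in> carrier A. \<rho> g a \<in> M}"
    have "alg_ideal F C A ?M'"
      by (rule A.alg_ideal_vimage[OF \<rho>'(1)[OF g] A.operad_algebra_axioms A.cosimple_idealD(1)[OF M]])
    moreover have "M \<subseteq> ?M'"
      using sub ker \<rho>_cl[OF g] A.alg_idealD(1)[OF A.cosimple_idealD(1)[OF M]] by blast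
    moreover have "?M' \<noteq> carrier A"
    proof
      assume eq: "?M' = carrier A"
      have "\<rho> g ` carrier A \<subseteq> M" using eq by blast
      then have "carrier A \<subseteq> M" using \<rho>'(2)[OF g] by (simp add: bij_betw_def)
      then show False
        using A.cosimple_idealD(3)[OF M] A.alg_idealD(1)[OF A.cosimple_idealD(1)[OF M]] by blast
    qed
    ultimately have "?M' = M" using A.cosimple_idealD(2)[OF M] by blast
    then show ?thesis using g by (auto simp: H_def)
  qed
  have faithful: "a = \<zero>\<^bsub>A\<^esub>" if "a \<in> carrier A" "\<forall>g\<in>carrier G. p (\<rho> g a) = \<zero>\<^bsub>B\<^esub>" for a
    using that ker \<rho>_cl by (intro core) auto
  have "induced_quotient F C G A \<rho> H B \<phi> p"
    unfolding induced_quotient_def using p surj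
    by (intro conjI ballI impI) (assumption | rule \<phi>_p stab faithful, assumption+)+
  then have "induced_presentation F C G A \<rho> H B \<phi>"
    by (rule presentation_if_induced_quotient[OF G fin A H simple \<phi>])
  then show ?thesis by blast
qed

text \<open>Let \<open>p\<close> and \<open>q\<close> be the evaluations at \<open>1\<close> of two presentations. The kernels of \<open>a \<mapsto> p(xa)\<close>
  intersect in zero, so by primality one of them is contained in the kernel of \<open>q\<close>, and by
  maximality they are equal. Then \<open>q\<close> is the composite of \<open>a \<mapsto> p(xa)\<close> with an isomorphism
  \<open>B \<rightarrow> B'\<close>. The stabilizers of the two kernels, \<open>H'\<close> and \<open>x\<^sup>-\<^sup>1Hx\<close>, agree, so \<open>g = x\<^sup>-\<^sup>1\<close>
  conjugates one presentation to the other.\<close>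

lemma induced_presentation_unique:
  assumes G: "group G" and fin: "finite (carrier G)" and A: "equivariant_algebra F C G A \<rho>"
    and pres: "induced_presentation F C G A \<rho> H B \<phi>"
    and pres': "induced_presentation F C G A \<rho> H' B' \<phi>'"
  shows "\<exists>g\<in>carrier G. H' = (\<lambda>h. g \<otimes>\<^bsub>G\<^esub> h \<otimes>\<^bsub>G\<^esub> inv\<^bsub>G\<^esub> g) ` H \<and>
          (\<exists>\<psi>\<in>alg_iso F C B B'. \<forall>h\<in>H. \<forall>b\<in>carrier B.
             \<phi>' (g \<otimes>\<^bsub>G\<^esub> h \<otimes>\<^bsub>G\<^esub> inv\<^bsub>G\<^esub> g) (\<psi> b) = \<psi> (\<phi> h b))"
proof -
  interpret group G by (rule G)
  interpret A: operad_algebra F C A using A by (simp add: equivariant_algebra_def)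
  have \<rho>: "\<rho> \<in> hom G (alg_Aut F C A)" using A by (simp add: equivariant_algebra_def)
  note \<rho>' = hom_alg_AutD[OF G \<rho>]
  have \<rho>_cl: "\<rho> g a \<in> carrier A" if "g \<in> carrier G" "a \<in> carrier A" for g a
    using bij_betwE[OF \<rho>'(2)[OF that(1)]] that(2) by blast
  have H: "subgroup H G" and B: "simple_algebra F C B"
    and \<phi>: "\<phi> \<in> hom (G\<lparr>carrier := H\<rparr>) (alg_Aut F C B)"
    using pres by (auto simp: induced_presentation_def)
  have H': "subgroup H' G" and B': "simple_algebra F C B'"
    and \<phi>': "\<phi>' \<in> hom (G\<lparr>carrier := H'\<rparr>) (alg_Aut F C B')"
    using pres' by (auto simp: induced_presentation_def)
  have \<phi>_zero: "\<phi> h \<zero>\<^bsub>B\<^esub> = \<zero>\<^bsub>B\<^esub>" if "h \<in> H" for h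
    using hom_alg_AutD(1)[OF subgroup.subgroup_is_group[OF H G] \<phi>, of h] that
      linear_mapD(6)[OF alg_homD(1)] by fastforce
  have \<phi>'_zero: "\<phi>' h \<zero>\<^bsub>B'\<^esub> = \<zero>\<^bsub>B'\<^esub>" if "h \<in> H'" for h
    using hom_alg_AutD(1)[OF subgroup.subgroup_is_group[OF H' G] \<phi>', of h] that
      linear_mapD(6)[OF alg_homD(1)] by fastforce
  obtain p where "induced_quotient F C G A \<rho> H B \<phi> p"
    using induced_quotient_if_presentation[OF G pres A] by blast
  note p = induced_quotientD[OF this]
  obtain q where "induced_quotient F C G A \<rho> H' B' \<phi>' q"
    using induced_quotient_if_presentation[OF G pres' A] by blast
  note q = induced_quotientD[OF this]
  define M where "M x = {a \<in> carrier A. p (\<rho> x a) = \<zero>\<^bsub>B\<^esub>}" for x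
  let ?K = "{a \<in> carrier A. q a = \<zero>\<^bsub>B'\<^esub>}"
  have p\<rho>: "(\<lambda>a. p (\<rho> x a)) \<in> alg_hom F C A B" if "x \<in> carrier G" for x
    by (rule alg_hom_comp[OF \<rho>'(1)[OF that] p(1)])
  have p\<rho>_surj: "(\<lambda>a. p (\<rho> x a)) ` carrier A = carrier B" if "x \<in> carrier G" for x
    using \<rho>'(2)[OF that] p(2) by (metis bij_betw_imp_surj_on image_image)
  have M: "cosimple_ideal F C A (M x)" if "x \<in> carrier G" for x
    unfolding M_def by (rule A.cosimple_ideal_ker[OF p\<rho>[OF that] p\<rho>_surj[OF that] B])
  have K: "cosimple_ideal F C A ?K"
    by (rule A.cosimple_ideal_ker[OF q(1,2) B'])
  have "carrier A \<inter> (\<Inter>x\<in>carrier G. M x) \<subseteq> ?K"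
  proof
    fix a assume a: "a \<in> carrier A \<inter> (\<Inter>x\<in>carrier G. M x)"
    then have "a = \<zero>\<^bsub>A\<^esub>" by (intro p(5)) (auto simp: M_def)
    then show "a \<in> ?K" using A.alg_idealD(2)[OF A.cosimple_idealD(1)[OF K]] by simp
  qed
  then obtain x where x: "x \<in> carrier G" and "M x \<subseteq> ?K"
    using A.cosimple_ideal_prime_Inter[OF K fin, of M] A.cosimple_idealD(1)[OF M] by blast
  then have MK: "M x = ?K"
    using A.cosimple_idealD(2)[OF M[OF x] A.cosimple_idealD(1)[OF K]] A.cosimple_idealD(3)[OF K]
    by blast
  have ker: "p (\<rho> x a) = \<zero>\<^bsub>B\<^esub> \<longleftrightarrow> q a = \<zero>\<^bsub>B'\<^esub>" if "a \<in> carrier A" for a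
    using MK that by (auto simp: M_def)
  obtain \<psi> where \<psi>: "\<psi> \<in> alg_iso F C B B'" and \<psi>_p: "\<And>a. a \<in> carrier A \<Longrightarrow> \<psi> (p (\<rho> x a)) = q a"
    using alg_iso_from_equal_kernels[OF A.opn_closed p\<rho>[OF x] p\<rho>_surj[OF x] q(1,2) ker] by blast
  define g where "g = inv\<^bsub>G\<^esub> x"
  have g: "g \<in> carrier G" and inv_g: "inv\<^bsub>G\<^esub> g = x" using x by (simp_all add: g_def)
  have conj: "\<rho> x (\<rho> (g \<otimes>\<^bsub>G\<^esub> h \<otimes>\<^bsub>G\<^esub> x) a) = \<rho> h (\<rho> x a)"
    if "h \<in> carrier G" "a \<in> carrier A" for h a
  proof -
    have "\<rho> x (\<rho> (g \<otimes>\<^bsub>G\<^esub> h \<otimes>\<^bsub>G\<^esub> x) a) = \<rho> (x \<otimes>\<^bsub>G\<^esub> (g \<otimes>\<^bsub>G\<^esub> h \<otimes>\<^bsub>G\<^esub> x)) a"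
      using that x g by (simp add: \<rho>'(3))
    also have "x \<otimes>\<^bsub>G\<^esub> (g \<otimes>\<^bsub>G\<^esub> h \<otimes>\<^bsub>G\<^esub> x) = h \<otimes>\<^bsub>G\<^esub> x"
      using that(1) x by (simp add: g_def flip: m_assoc)
    finally show ?thesis using that x by (simp add: \<rho>'(3))
  qed
  have HG: "h \<in> carrier G" if "h \<in> H" for h using that subgroup.subset[OF H] by blast
  have in_H': "g \<otimes>\<^bsub>G\<^esub> h \<otimes>\<^bsub>G\<^esub> x \<in> H'" if h: "h \<in> H" for h
  proof (rule q(4))
    show cl: "g \<otimes>\<^bsub>G\<^esub> h \<otimes>\<^bsub>G\<^esub> x \<in> carrier G" using g x HG[OF h] by simp
    fix a assume a: "a \<in> carrier A" "q a = \<zero>\<^bsub>B'\<^esub>"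
    have "p (\<rho> h (\<rho> x a)) = \<zero>\<^bsub>B\<^esub>"
      using ker[OF a(1)] a p(3)[OF h \<rho>_cl[OF x a(1)]] \<phi>_zero[OF h] by simp
    then show "q (\<rho> (g \<otimes>\<^bsub>G\<^esub> h \<otimes>\<^bsub>G\<^esub> x) a) = \<zero>\<^bsub>B'\<^esub>"
      using ker[OF \<rho>_cl[OF cl a(1)]] conj[OF HG[OF h] a(1)] by simp
  qed
  have in_H: "x \<otimes>\<^bsub>G\<^esub> h' \<otimes>\<^bsub>G\<^esub> g \<in> H" if h': "h' \<in> H'" for h'
  proof (rule p(4))
    have h'G: "h' \<in> carrier G" using h' subgroup.subset[OF H'] by blast
    show "x \<otimes>\<^bsub>G\<^esub> h' \<otimes>\<^bsub>G\<^esub> g \<in> carrier G" using g x h'G by simp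
    fix a assume a: "a \<in> carrier A" "p a = \<zero>\<^bsub>B\<^esub>"
    have ga: "\<rho> g a \<in> carrier A" using g a \<rho>_cl by simp
    have "p (\<rho> x (\<rho> g a)) = \<zero>\<^bsub>B\<^esub>" using x g a by (simp add: g_def \<rho>'(4) flip: \<rho>'(3))
    then have "q (\<rho> h' (\<rho> g a)) = \<zero>\<^bsub>B'\<^esub>" using ker[OF ga] q(3)[OF h' ga] \<phi>'_zero[OF h'] by simp
    then have "p (\<rho> x (\<rho> h' (\<rho> g a))) = \<zero>\<^bsub>B\<^esub>" using ker[OF \<rho>_cl[OF h'G ga]] by simp
    then show "p (\<rho> (x \<otimes>\<^bsub>G\<^esub> h' \<otimes>\<^bsub>G\<^esub> g) a) = \<zero>\<^bsub>B\<^esub>" using x g h'G a ga by (simp add: \<rho>'(3) \<rho>_cl)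
  qed
  have "H' = (\<lambda>h. g \<otimes>\<^bsub>G\<^esub> h \<otimes>\<^bsub>G\<^esub> x) ` H"
  proof (intro equalityI subsetI)
    fix h' assume h': "h' \<in> H'"
    then have "h' \<in> carrier G" using subgroup.subset[OF H'] by blast
    then have "h' = g \<otimes>\<^bsub>G\<^esub> (x \<otimes>\<^bsub>G\<^esub> h' \<otimes>\<^bsub>G\<^esub> g) \<otimes>\<^bsub>G\<^esub> x"
      using x by (simp add: g_def m_assoc) (simp add: flip: m_assoc)
    then show "h' \<in> (\<lambda>h. g \<otimes>\<^bsub>G\<^esub> h \<otimes>\<^bsub>G\<^esub> x) ` H" using in_H[OF h'] by blast
  qed (use in_H' in blast)
  moreover have "\<phi>' (g \<otimes>\<^bsub>G\<^esub> h \<otimes>\<^bsub>G\<^esub> x) (\<psi> b) = \<psi> (\<phi> h b)" if h: "h \<in> H" and b: "b \<in> carrier B" for h b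
  proof -
    obtain a where a: "a \<in> carrier A" "b = p (\<rho> x a)" using b p\<rho>_surj[OF x] by blast
    have cl: "g \<otimes>\<^bsub>G\<^esub> h \<otimes>\<^bsub>G\<^esub> x \<in> carrier G" using g x HG[OF h] by simp
    have "\<phi>' (g \<otimes>\<^bsub>G\<^esub> h \<otimes>\<^bsub>G\<^esub> x) (\<psi> b) = q (\<rho> (g \<otimes>\<^bsub>G\<^esub> h \<otimes>\<^bsub>G\<^esub> x) a)"
      using a q(3)[OF in_H'[OF h] a(1)] by (simp add: \<psi>_p)
    also have "\<dots> = \<psi> (p (\<rho> h (\<rho> x a)))"
      using \<psi>_p[OF \<rho>_cl[OF cl a(1)]] conj[OF HG[OF h] a(1)] by simp
    also have "\<dots> = \<psi> (\<phi> h b)" using p(3)[OF h \<rho>_cl[OF x a(1)]] a(2) by simp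
    finally show ?thesis .
  qed
  ultimately show ?thesis
    using \<psi> by (intro bexI[OF _ g] conjI bexI[of _ \<psi>]) (auto simp: inv_g)
qed

theorem theorem2p2:
  fixes F :: "('k, 'm) ring_scheme"
    and C :: "('k, 'c) operad"
    and G :: "('g, 'n) monoid_scheme"
    and A :: "('k, 'c, 'a) operad_alg"
    and \<rho> :: "'g \<Rightarrow> 'a \<Rightarrow> 'a"
  assumes "field F"
    and "linear_operad F C"
    and "group G" and "finite (carrier G)"
    and "simple_equivariant_algebra F C G A \<rho>"
  shows "(\<exists>H (B :: ('k, 'c, 'a) operad_alg) \<phi>. induced_presentation F C G A \<rho> H B \<phi>) \<and>
    (\<forall>H (B :: ('k, 'c, 'b1) operad_alg) \<phi> H' (B' :: ('k, 'c, 'b2) operad_alg) \<phi>'.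
       induced_presentation F C G A \<rho> H B \<phi> \<longrightarrow>
       induced_presentation F C G A \<rho> H' B' \<phi>' \<longrightarrow>
       (\<exists>g\<in>carrier G. H' = (\<lambda>h. g \<otimes>\<^bsub>G\<^esub> h \<otimes>\<^bsub>G\<^esub> inv\<^bsub>G\<^esub> g) ` H \<and>
          (\<exists>\<psi>\<in>alg_iso F C B B'. \<forall>h\<in>H. \<forall>b\<in>carrier B.
             \<phi>' (g \<otimes>\<^bsub>G\<^esub> h \<otimes>\<^bsub>G\<^esub> inv\<^bsub>G\<^esub> g) (\<psi> b) = \<psi> (\<phi> h b))))"
proof -
  have "equivariant_algebra F C G A \<rho>"
    using assms(5) by (simp add: simple_equivariant_algebra_def)
  then show ?thesis
    by (intro conjI allI impI induced_presentation_exists[OF assms(3-5)]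
        induced_presentation_unique[OF assms(3,4)])
qed

end
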